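(* Let $\lambda<\kappa$ be regular cardinals and assume that $\mathrm{GC}_\lambda$-characterization holds for $\kappa$. Then the order $\langle\mathcal P(\kappa),\subset_{\mathrm{NS}(\lambda)}\rangle$ can be embedded into $\langle\mathcal E^B_\kappa,\le_B\rangle$ strictly between $\mathrm{id}_{2^\kappa}$ and $E_0$. More precisely, there exists a one-to-one map $F\colon\mathcal P(\kappa)\to\mathcal E^B_\kappa$ such that for all $X,Y\in\mathcal P(\kappa)$ we have $\mathrm{id}_{2^\kappa}\lneq_B F(X)\lneq_B E_0$ and $$X\subset_{\mathrm{NS}(\lambda)}Y\iff F(X)\le_B F(Y).$$
   Context: Throughout, $\kappa$ is an uncountable regular cardinal with $\kappa^{<\kappa}=\kappa$ (i.e. $|\kappa^\alpha|=\kappa$ for all $0<\alpha<\kappa$); regular cardinals are infinite. The space $2^\kappa$ of all functions $\kappa\to\{0,1\}$ carries the topology generated by the sets $N_p=\{\eta\in 2^\kappa\mid \eta\restriction\alpha=p\}$ for $\alpha<\kappa$, $p\in 2^\alpha$. Borel sets are obtained by closing the topology under unions and intersections of length $\le\kappa$ and complements (likewise for $(2^\kappa)^2$ with the product topology). A function is Borel if inverse images of open sets are Borel. For equivalence relations $E,E'$ on $2^\kappa$, $E\le_B E'$ means that there is a Borel function $f\colon 2^\kappa\to2^\kappa$ with $(\eta,\xi)\in E\iff(f(\eta),f(\xi))\in E'$ for all $\eta,\xi$; $E\lneq_B E'$ means $E\le_B E'$ and $E'\not\le_B E$. $\mathcal E^B_\kappa$ is the set of equivalence relations on $2^\kappa$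 that are Borel subsets of $(2^\kappa)^2$. $\mathrm{id}_{2^\kappa}$ is the identity (equality) relation on $2^\kappa$, and $(\eta,\xi)\in E_0$ iff $\{\alpha<\kappa\mid\eta(\alpha)\ne\xi(\alpha)\}$ is bounded in $\kappa$. For regular $\lambda<\kappa$, a set $C\subset\kappa$ is $\lambda$-closed if for every increasing sequence $\langle\alpha_i\in C\mid i<\lambda\rangle$ the limit $\sup_{i<\lambda}\alpha_i$ is in $C$; it is $\lambda$-cub if it is $\lambda$-closed and unbounded in $\kappa$. A set is $\lambda$-stationary if it intersects every $\lambda$-cub set. $X\subset_{\mathrm{NS}(\lambda)}Y$ means that $X\setminus Y$ is not $\lambda$-stationary. For $A\subset\kappa$, the game $\mathrm{GC}_\lambda(A)$ between players I and II has $\lambda$ moves; at the $i$-th move player I picks an ordinal $\alpha_i<\kappa$ greater than any ordinal picked earlier in the game and then II picks an ordinal $\beta_i<\kappa$ with $\beta_i>\alpha_i$. Player II wins if $\sup_{i<\lambda}\alpha_i\in A$; otherwise I wins. $\mathrm{GC}_\lambda$-characterization holds for $\kappa$ if, for all $A\subset\kappa$, player II has a winning strategy in $\mathrm{GC}_\lambda(A)$ if and only if $A$ contains a $\lambda$-cub set. *)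

theory Defs
  imports "HOL-Analysis.Function_Topology" "HOL-Analysis.Product_Topology" "HOL-Library.FuncSet"
begin

unbundle cardinal_syntax

text \<open>
  The cardinal \<open>\<kappa>\<close> is the order type of a well-ordered type \<open>'k\<close>: the elements of \<open>'k\<close> are the
  ordinals below \<open>\<kappa>\<close>, the element \<open>a\<close> is identified with the set \<open>{..<a}\<close> of its predecessors,
  \<open>'k set\<close> is the power set of \<open>\<kappa>\<close>, and \<open>'k \<Rightarrow> bool\<close> is \<open>2\<^sup>\<kappa>\<close>. That this order type is a
  cardinal is stated as a property of the relation below.
\<close>

definition kappa :: "'k::wellorder rel" where
  "kappa = {(x, y). x \<le> y}"

definition regular_cardinal :: "'a rel \<Rightarrow> bool" where
  "regular_cardinal r \<longleftrightarrow> Cinfinite r \<and> regularCard r"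

definition regular_below :: "'k::wellorder \<Rightarrow> bool" where
  "regular_below l \<longleftrightarrow> regular_cardinal (Restr kappa {..<l})"


subsection \<open>The generalized Cantor space and Borel reducibility\<close>

definition basic_nbhd :: "'k::wellorder \<Rightarrow> ('k \<Rightarrow> bool) \<Rightarrow> ('k \<Rightarrow> bool) set" where
  "basic_nbhd a p = {\<eta>. \<forall>b<a. \<eta> b = p b}"

definition cantor_top :: "('k::wellorder \<Rightarrow> bool) topology" where
  "cantor_top = topology_generated_by {basic_nbhd a p | a p. True}"

inductive_set borel_of_length :: "'b rel \<Rightarrow> 'a topology \<Rightarrow> 'a set set"
  for r :: "'b rel" and T :: "'a topology" where
  open_set: "openin T U \<Longrightarrow> U \<in> borel_of_length r T"
| complement: "A \<in> borel_of_length r T \<Longrightarrow> topspace T - A \<in> borel_of_length r T"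
| union: "|S| \<le>o r \<Longrightarrow> (\<And>A. A \<in> S \<Longrightarrow> A \<in> borel_of_length r T) \<Longrightarrow> \<Union>S \<in> borel_of_length r T"
| intersection: "S \<noteq> {} \<Longrightarrow> |S| \<le>o r \<Longrightarrow> (\<And>A. A \<in> S \<Longrightarrow> A \<in> borel_of_length r T) \<Longrightarrow>
    \<Inter>S \<in> borel_of_length r T"

definition borel_function :: "(('k::wellorder \<Rightarrow> bool) \<Rightarrow> ('k \<Rightarrow> bool)) \<Rightarrow> bool" where
  "borel_function f \<longleftrightarrow>
     (\<forall>U. openin cantor_top U \<longrightarrow> f -` U \<in> borel_of_length (kappa :: 'k rel) cantor_top)"

definition borel_reducible :: "('k::wellorder \<Rightarrow> bool) rel \<Rightarrow> ('k \<Rightarrow> bool) rel \<Rightarrow> bool"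
    (infix "\<le>\<^sub>B" 50) where
  "E \<le>\<^sub>B E' \<longleftrightarrow>
     (\<exists>f. borel_function f \<and> (\<forall>\<eta> \<xi>. (\<eta>, \<xi>) \<in> E \<longleftrightarrow> (f \<eta>, f \<xi>) \<in> E'))"

definition strictly_borel_reducible :: "('k::wellorder \<Rightarrow> bool) rel \<Rightarrow> ('k \<Rightarrow> bool) rel \<Rightarrow> bool"
    (infix "<\<^sub>B" 50) where
  "E <\<^sub>B E' \<longleftrightarrow> E \<le>\<^sub>B E' \<and> \<not> E' \<le>\<^sub>B E"

definition borel_equivs :: "('k::wellorder \<Rightarrow> bool) rel set" where
  "borel_equivs =
     {E. equiv UNIV E \<and> E \<in> borel_of_length (kappa :: 'k rel) (prod_topology cantor_top cantor_top)}"

definition E0 :: "('k::wellorder \<Rightarrow> bool) rel" where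
  "E0 = {(\<eta>, \<xi>). bdd_above {a. \<eta> a \<noteq> \<xi> a}}"


subsection \<open>Cub sets, stationary sets, and the cub game at a regular cardinal below kappa\<close>

text \<open>
  The supremum of a sequence of length \<open>l\<close>. The least element is meaningful only if the sequence
  is bounded, which is always the case when \<open>\<kappa>\<close> is regular.
\<close>

definition seq_sup :: "'k::wellorder \<Rightarrow> ('k \<Rightarrow> 'k) \<Rightarrow> 'k" where
  "seq_sup l f = (LEAST u. \<forall>i<l. f i \<le> u)"

definition l_closed :: "'k::wellorder \<Rightarrow> 'k set \<Rightarrow> bool" where
  "l_closed l C \<longleftrightarrow>
     (\<forall>f. strict_mono_on {..<l} f \<and> (\<forall>i<l. f i \<in> C) \<longrightarrow> seq_sup l f \<in> C)"

definition l_cub :: "'k::wellorder \<Rightarrow> 'k set \<Rightarrow> bool" where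
  "l_cub l C \<longleftrightarrow> l_closed l C \<and> \<not> bdd_above C"

definition l_stationary :: "'k::wellorder \<Rightarrow> 'k set \<Rightarrow> bool" where
  "l_stationary l S \<longleftrightarrow> (\<forall>C. l_cub l C \<longrightarrow> S \<inter> C \<noteq> {})"

definition subset_NS :: "'k::wellorder \<Rightarrow> 'k set \<Rightarrow> 'k set \<Rightarrow> bool" where
  "subset_NS l X Y \<longleftrightarrow> \<not> l_stationary l (X - Y)"

text \<open>
  In a play, \<open>\<alpha> i\<close> and \<open>\<beta> i\<close> are the \<open>i\<close>-th moves of players I and II. A strategy of II maps a
  stage \<open>i\<close> and the moves \<open>(\<alpha> j)\<close>, \<open>j \<le> i\<close>, of I so far to the answer of II; the earlier moves of
  II are determined by these. Player II has to move legally as long as I has done so, and has to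
  win every play in which I always moves legally.
\<close>

definition legal_I_at :: "('k::wellorder \<Rightarrow> 'k) \<Rightarrow> ('k \<Rightarrow> 'k) \<Rightarrow> 'k \<Rightarrow> bool" where
  "legal_I_at \<alpha> \<beta> i \<longleftrightarrow> (\<forall>j<i. \<alpha> j < \<alpha> i \<and> \<beta> j < \<alpha> i)"

definition winning_II ::
    "'k::wellorder \<Rightarrow> 'k set \<Rightarrow> ('k \<Rightarrow> ('k \<Rightarrow> 'k) \<Rightarrow> 'k) \<Rightarrow> bool" where
  "winning_II l A \<sigma> \<longleftrightarrow>
     (\<forall>\<alpha> \<beta>. (\<forall>i<l. \<beta> i = \<sigma> i (restrict \<alpha> {..i})) \<longrightarrow>
        (\<forall>i<l. (\<forall>j\<le>i. legal_I_at \<alpha> \<beta> j) \<longrightarrow> \<alpha> i < \<beta> i) \<and>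
        ((\<forall>i<l. legal_I_at \<alpha> \<beta> i) \<longrightarrow> seq_sup l \<alpha> \<in> A))"

definition GC_characterization :: "'k::wellorder \<Rightarrow> bool" where
  "GC_characterization l \<longleftrightarrow>
     (\<forall>A. (\<exists>\<sigma>. winning_II l A \<sigma>) \<longleftrightarrow> (\<exists>C\<subseteq>A. l_cub l C))"

end

theory Submission
  imports Defs
begin

text \<open>
  The idea. Write \<open>D\<close> for the set of places where two points of \<open>2\<^sup>\<kappa>\<close> differ. A relation finer than
  \<open>E0\<close> asks in addition that \<open>D\<close> behaves well below certain limit points \<open>a\<close> of cofinality \<open>\<lambda>\<close>. If
  "well" meant that \<open>D\<close> is bounded below \<open>a\<close>, then for a stationary set of such \<open>a\<close> the relation
  would be smooth, since an unbounded \<open>D\<close> has stationarily many limits of this kind. Therefore \<open>D\<close> is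
  allowed to be bounded or co-bounded below \<open>a\<close> (\<open>good\<close>). A bounded stretch of flips is then always
  harmless, which gives generic ergodicity and keeps the relations away from the identity, but a set
  that is cofinal and co-cofinal below \<open>a\<close> is forbidden.

  With the conditions imposed at a stationary set \<open>S\<close> the relation is reducible to \<open>E0\<close> but not
  conversely; with \<open>S\<close> empty it is \<open>E0\<close> itself. As \<open>F X\<close> has to stay below \<open>E0\<close> for every \<open>X\<close>, two
  copies are used: split the limit points into stationary sets \<open>A\<close> and \<open>B\<close> (\<open>stationary_splitting\<close>),
  split the coordinates into cells, and drop the conditions for the first cell at \<open>X \<inter> A\<close> only, and
  those for the second cell at \<open>X - A\<close> only. Each cell then keeps a stationary set of conditions, and
  the limit points that carry both conditions are those outside \<open>X\<close>. The remaining cells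
  carry equality, which makes room for coding; one of their coordinates switches on further equalities
  that make the map one-to-one.

  Reductions (\<open>R_le_R\<close>). Up to a bounded set and a flip, the difference set in a cell is determined by
  its germs at a stationary set of limit points, by \<open>stationary_good\<close>. So all of \<open>F X\<close> except one bit
  per cell is a continuous invariant, to be copied into an equality cell. If a cub set \<open>C\<close> misses
  \<open>X - Y\<close>, the remaining bits can be sampled along \<open>C\<close>, so that within a cell the images can change
  between agreement and disagreement cofinally often only below points of \<open>C\<close>.

  Non-reductions (\<open>nonreduction\<close>). A Borel function is continuous on a comeager set, by the Baire
  property of Borel sets. Given a reduction, one builds two points by initial segments and forces their
  images to differ and to agree again and again (\<open>difference_step\<close>, \<open>agreement_step\<close>), changing the
  difference set of the two points only by bounded intervals. The lengths are played in the cub game,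
  and since player II has no winning strategy for the complement of a stationary set, the play can be
  assumed to end at a point \<open>a\<close> of this set (\<open>game\<close>). If the source has no condition at \<open>a\<close>, the two
  points are equivalent, but their images violate the condition at \<open>a\<close>.
\<close>

section \<open>Ordinals below a regular cardinal\<close>

lemma wo_rel_kappa: "well_order_on UNIV (kappa :: 'k::wellorder rel)"
proof -
  have "wf ((kappa :: 'k rel) - Id)"
    using wf by (rule wf_subset) (auto simp: kappa_def)
  then show ?thesis
    by (auto simp: well_order_on_def linear_order_on_def partial_order_on_def preorder_on_def
        refl_on_def trans_def antisym_def total_on_def kappa_def)
qed

lemma Field_kappa [simp]: "Field (kappa :: 'k::wellorder rel) = UNIV"
  using wo_rel_kappa by (simp add: order_on_defs refl_on_def Field_def kappa_def) blast

lemma range_ordLeq_kappa: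
  fixes e :: "'k::wellorder \<Rightarrow> 'c"
  shows "|range e| \<le>o (kappa :: 'k rel)"
  using card_of_image[of e UNIV] card_of_least[OF wo_rel_kappa[where 'k='k]] ordLeq_transitive by blast

lemma ordLeq_kappa_enumeration:
  assumes "|S| \<le>o (kappa :: 'k::wellorder rel)" "S \<noteq> {}"
  shows "\<exists>e :: 'k \<Rightarrow> 'c. S = range e"
proof -
  have "|Field |S| | \<le>o |Field (kappa :: 'k rel)|"
    using assms(1) by (rule card_of_mono2)
  then have "|S| \<le>o |UNIV :: 'k set|"
    by (simp only: Field_kappa Field_card_of)
  then show ?thesis
    using assms(2) card_of_ordLeq2[of S "UNIV :: 'k set"] by metis
qed

lemma regular_bound:
  assumes "regular_cardinal (Restr kappa T)" "j \<in> T" "\<And>x y. x < y \<Longrightarrow> y \<in> T \<Longrightarrow> x \<in> T"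
    and "\<And>k. k < j \<Longrightarrow> h k \<in> T"
  shows "\<exists>b\<in>T. \<forall>k<j. h k < (b :: 'k::wellorder)"
proof -
  let ?r = "Restr kappa T"
  have inf: "Cinfinite ?r" and reg: "regularCard ?r"
    using assms(1) by (auto simp: regular_cardinal_def)
  have F: "Field ?r = T"
    by (auto simp: Field_def kappa_def)
  have small: "|{..<j}| <o ?r"
  proof -
    have "underS ?r j = {..<j}"
      using assms(2,3) by (auto simp: underS_def kappa_def)
    then show ?thesis
      using card_of_underS[of ?r j] inf assms(2) F by simp
  qed
  have lim: "\<exists>b\<in>T. a < b" if "a \<in> T" for a
  proof -
    have "\<not> finite (Field ?r)"
      using inf by (simp add: cinfinite_def)
    then have "\<exists>b\<in>Field ?r. a \<noteq> b \<and> (a, b) \<in> ?r"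
      using infinite_Card_order_limit[of ?r a] inf that F by simp
    then obtain b where "b \<in> Field ?r" "a \<noteq> b" "(a, b) \<in> ?r"
      by blast
    then show ?thesis
      using F by (intro bexI[of _ b]) (auto simp: kappa_def)
  qed
  have "\<not> cofinal (h ` {..<j}) ?r"
  proof
    assume "cofinal (h ` {..<j}) ?r"
    moreover have "h ` {..<j} \<subseteq> Field ?r"
      using assms(4) F by auto
    ultimately have "|h ` {..<j}| =o ?r"
      using reg by (simp only: regularCard_def)
    moreover have "|h ` {..<j}| <o ?r"
      by (rule ordLeq_ordLess_trans[OF card_of_image small])
    ultimately show False
      by (simp add: not_ordLess_ordIso)
  qed
  then obtain a where a: "a \<in> T" "\<forall>b\<in>h ` {..<j}. \<not> (a \<noteq> b \<and> (a, b) \<in> ?r)"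
    unfolding cofinal_def F by auto
  then have "\<forall>k<j. h k \<le> a"
    using assms(4) by (auto simp: kappa_def) (metis lessThan_iff linear order_refl)
  moreover obtain b where "b \<in> T" "a < b"
    using lim a by blast
  ultimately show ?thesis
    by (auto intro: order.strict_trans1)
qed

text \<open>
  Regularity is used in the form that functions on a proper initial segment are bounded, in \<open>\<kappa>\<close> and
  in \<open>\<lambda>\<close>. The bijection \<open>dec\<close> splits \<open>\<kappa>\<close> into infinitely many cells of full size, each indexed by
  pairs of ordinals; it is the bookkeeping device for all codings.
\<close>

locale regular_pair =
  fixes l :: "'k::wellorder" and dec :: "'k \<Rightarrow> nat \<times> 'k \<times> 'k"
  assumes bounded_family: "\<And>(f :: 'k \<Rightarrow> 'k) a. \<exists>b. \<forall>i<a. f i < b"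
    and l_bounded_family: "\<And>j h. j < l \<Longrightarrow> (\<And>k. k < j \<Longrightarrow> h k < l) \<Longrightarrow> \<exists>b<l. \<forall>k<j. h k < b"
    and l_pos: "\<exists>i. i < l"
    and l_limit: "\<And>i. i < l \<Longrightarrow> \<exists>b<l. i < b"
    and bij_dec: "bij dec"

lemma regular_pair_exists:
  fixes l :: "'k::wellorder"
  assumes "regular_cardinal (kappa :: 'k rel)" "regular_below l"
  shows "\<exists>dec. regular_pair l dec"
proof -
  have 1: "\<exists>b. \<forall>i<a. f i < b" for f :: "'k \<Rightarrow> 'k" and a
    using regular_bound[of UNIV a f] assms(1) by simp
  have 2: "\<exists>b<l. \<forall>k<j. h k < b" if "j < l" "\<And>k. k < j \<Longrightarrow> h k < l" for j h
  proof -
    have "x \<in> {..<l}" if "x < y" "y \<in> {..<l}" for x y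
      using that by auto
    then show ?thesis
      using regular_bound[of "{..<l}" j h] assms(2) that by (auto simp: regular_below_def)
  qed
  let ?r = "Restr kappa {..<l}"
  have F: "Field ?r = {..<l}"
    by (auto simp: Field_def kappa_def)
  have inf: "\<not> finite {..<l}"
    using assms(2) F by (simp add: regular_below_def regular_cardinal_def cinfinite_def)
  have 3: "\<exists>i. i < l"
  proof -
    have "{..<l} \<noteq> {}"
      using inf by (metis finite.emptyI)
    then show ?thesis
      by auto
  qed
  have 4: "\<exists>b<l. i < b" if "i < l" for i
  proof -
    have "\<exists>b\<in>Field ?r. i \<noteq> b \<and> (i, b) \<in> ?r"
      using infinite_Card_order_limit[of ?r i] assms(2) that inf
      unfolding F regular_below_def regular_cardinal_def by auto
    then show ?thesis
      by (auto simp: kappa_def)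
  qed
  have infk: "\<not> finite (UNIV :: 'k set)"
    using inf rev_finite_subset[OF _ subset_UNIV, of "{..<l}"] by blast
  have sq: "|UNIV :: ('k \<times> 'k) set| =o |UNIV :: 'k set|"
    using card_of_Times_same_infinite[OF infk] by simp
  have infsq: "\<not> finite (UNIV :: ('k \<times> 'k) set)"
    using infk by (simp add: finite_prod)
  then have "|UNIV :: nat set| \<le>o |UNIV :: ('k \<times> 'k) set|"
    by (simp add: infinite_iff_card_of_nat)
  then have "|(UNIV :: nat set) \<times> (UNIV :: ('k \<times> 'k) set)| =o |UNIV :: ('k \<times> 'k) set|"
    using card_of_Times_infinite[OF infsq, of "UNIV :: nat set"] by blast
  then have "|UNIV :: (nat \<times> 'k \<times> 'k) set| =o |UNIV :: 'k set|"
    using sq by (simp only: UNIV_Times_UNIV) (rule ordIso_transitive)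
  then have "|UNIV :: 'k set| =o |UNIV :: (nat \<times> 'k \<times> 'k) set|"
    by (rule ordIso_symmetric)
  then obtain dec :: "'k \<Rightarrow> nat \<times> 'k \<times> 'k" where 5: "bij dec"
    using card_of_ordIso[of "UNIV :: 'k set" "UNIV :: (nat \<times> 'k \<times> 'k) set"] by blast
  have "regular_pair l dec"
    by (rule regular_pair.intro[OF 1 2 3 4 5])
  then show ?thesis
    by blast
qed

context regular_pair
begin

lemma ex_greater: "\<exists>b. (a :: 'k) < b"
proof -
  obtain i where "i < l"
    using l_pos by blast
  then show ?thesis
    using bounded_family[of l "\<lambda>_. a"] by blast
qed

lemma ex_greater2: "\<exists>c. a < c \<and> (b :: 'k) < c"
  using ex_greater[of "max a b"] by auto

lemma bounded_family_le: "\<exists>b. \<forall>i\<le>a. f i < (b :: 'k)" for f :: "'k \<Rightarrow> 'k"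
proof -
  obtain b c where "\<forall>i<a. f i < b" "b < c" "f a < c"
    using bounded_family[of a f] ex_greater2 by meson
  then show ?thesis
    using order_le_less[of _ a] by (auto intro: less_trans)
qed

lemma not_bdd_iff: "\<not> bdd_above C \<longleftrightarrow> (\<forall>b. \<exists>c\<in>C. (b :: 'k) < c)"
  unfolding bdd_above_def by (meson not_le)

lemma bdd_image: 
  fixes f :: "'k \<Rightarrow> 'k"
  assumes "bdd_above C"
  shows "bdd_above (f ` C)"
proof -
  obtain b where "\<forall>c\<in>C. c \<le> b"
    using assms by (auto simp: bdd_above_def)
  moreover obtain d where "\<forall>c\<le>b. f c < d"
    using bounded_family_le by blast
  ultimately show ?thesis
    by (auto simp: bdd_above_def intro!: exI[of _ d] less_imp_le)
qed

lemma unbounded_UNIV: "\<not> bdd_above (UNIV :: 'k set)"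
  using ex_greater by (auto simp: not_bdd_iff)

text \<open>
  A position with tag \<open>n\<close> lies in the \<open>n\<close>-th cell of coordinates; its two arguments say what is coded
  there.
\<close>

definition tag :: "'k \<Rightarrow> nat" where "tag a = fst (dec a)"
definition arg1 :: "'k \<Rightarrow> 'k" where "arg1 a = fst (snd (dec a))"
definition arg2 :: "'k \<Rightarrow> 'k" where "arg2 a = snd (snd (dec a))"
definition pos :: "nat \<Rightarrow> 'k \<Rightarrow> 'k \<Rightarrow> 'k" where "pos n a b = inv dec (n, a, b)"

lemma pos_simps [simp]:
  "tag (pos n a b) = n" "arg1 (pos n a b) = a" "arg2 (pos n a b) = b"
  using bij_dec by (auto simp: tag_def arg1_def arg2_def pos_def bij_is_surj surj_f_inv_f)

lemma pos_cover [simp]: "pos (tag a) (arg1 a) (arg2 a) = a"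
  using bij_dec by (simp add: tag_def arg1_def arg2_def pos_def bij_is_inj)

lemma unbounded_pos1: "\<not> bdd_above (pos n a ` C) \<longleftrightarrow> \<not> bdd_above C"
proof -
  have "C = arg2 ` pos n a ` C"
    by (auto simp: image_iff)
  then show ?thesis
    using bdd_image by metis
qed

lemma unbounded_pos2: "\<not> bdd_above ((\<lambda>b. pos n b a) ` C) \<longleftrightarrow> \<not> bdd_above C"
proof -
  have "C = arg1 ` (\<lambda>b. pos n b a) ` C"
    by (auto simp: image_iff)
  then show ?thesis
    using bdd_image by metis
qed

lemma unbounded_tag: "\<not> bdd_above {a. tag a = n}"
proof -
  have "pos n l ` UNIV \<subseteq> {a. tag a = n}"
    by auto
  then show ?thesis
    using unbounded_pos1[of n l UNIV] unbounded_UNIV bdd_above_mono[of _ "range (pos n l)"] by auto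
qed

section \<open>Cub and stationary sets\<close>

lemma le_seq_sup: "i < l \<Longrightarrow> f i \<le> seq_sup l f"
proof -
  obtain b where "\<forall>i<l. f i < b"
    using bounded_family by blast
  then have "\<exists>u. \<forall>i<l. f i \<le> u"
    by (meson less_imp_le)
  then have "\<forall>i<l. f i \<le> seq_sup l f"
    unfolding seq_sup_def by (rule LeastI_ex)
  then show "i < l \<Longrightarrow> f i \<le> seq_sup l f"
    by simp
qed

lemma less_seq_sup:
  assumes "strict_mono_on {..<l} f" "i < l"
  shows "f i < seq_sup l f"
proof -
  obtain j where "i < j" "j < l"
    using l_limit assms(2) by blast
  then have "f i < f j" "f j \<le> seq_sup l f"
    using assms le_seq_sup by (auto simp: strict_mono_on_def)
  then show ?thesis
    by simp
qed

lemma seq_sup_approx: "b < seq_sup l f \<Longrightarrow> \<exists>i<l. b < f i"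
  unfolding seq_sup_def using not_less_Least not_le by blast

lemma seq_sup_eqI:
  assumes "\<And>i. i < l \<Longrightarrow> f i \<le> a" "\<And>b. b < a \<Longrightarrow> \<exists>i<l. b < f i"
  shows "seq_sup l f = a"
  unfolding seq_sup_def
proof (rule Least_equality)
  show "a \<le> u" if "\<forall>i<l. f i \<le> u" for u
    using assms(2)[of u] that by (meson leI not_le)
qed (use assms in auto)

text \<open>The points of cofinality \<open>\<lambda>\<close>; these are the possible outcomes of a play of the game.\<close>

definition lim_points :: "'k set" where
  "lim_points = {seq_sup l f | f. strict_mono_on {..<l} f}"

definition cofinal_in :: "'k set \<Rightarrow> 'k \<Rightarrow> bool" where
  "cofinal_in C a \<longleftrightarrow> (\<forall>b<a. \<exists>c\<in>C. b < c \<and> c < a)"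

lemma not_cofinal_inD: "\<not> cofinal_in C a \<Longrightarrow> \<exists>b<a. \<forall>c\<in>C. b < c \<longrightarrow> \<not> c < a"
  by (auto simp: cofinal_in_def)

lemma lim_pointsD:
  assumes "a \<in> lim_points"
  shows "\<exists>f. strict_mono_on {..<l} f \<and> (\<forall>i<l. f i < a) \<and> (\<forall>b<a. \<exists>i<l. b < f i)"
  using assms less_seq_sup seq_sup_approx by (auto simp: lim_points_def)

lemma lim_points_less: "a \<in> lim_points \<Longrightarrow> \<exists>b. b < a"
  using lim_pointsD l_pos by blast

lemma lim_points_ge: "a \<in> lim_points \<Longrightarrow> l \<le> a"
proof -
  assume "a \<in> lim_points"
  then obtain f where f: "strict_mono_on {..<l} f" "\<And>i. i < l \<Longrightarrow> f i < a" "\<And>b. b < a \<Longrightarrow> \<exists>i<l. b < f i"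
    using lim_pointsD by blast
  have "i < l \<Longrightarrow> i \<le> f i" for i
  proof (induction i rule: less_induct)
    case (less i)
    have "j < f i" if "j < i" for j
      using less.IH[OF that] strict_mono_onD[OF f(1), of j i] that less.prems
      by (auto dest: less_trans[of j i l])
    then show ?case
      using leI by blast
  qed
  then show "l \<le> a"
    using f(2) leI order_le_less_trans by blast
qed

text \<open>Here the cofinality \<open>\<lambda>\<close> of a limit point matters: fewer than \<open>\<lambda>\<close> ordinals do not reach it.\<close>

lemma lim_points_bound:
  assumes a: "a \<in> lim_points" and j: "j < l" and h: "\<And>k. k < j \<Longrightarrow> h k < a"
  shows "\<exists>b<a. \<forall>k<j. h k < b"
proof -
  obtain f where f: "strict_mono_on {..<l} f" "\<And>i. i < l \<Longrightarrow> f i < a" "\<And>b. b < a \<Longrightarrow> \<exists>i<l. b < f i"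
    using a lim_pointsD by blast
  define g where "g k = (LEAST i. i < l \<and> h k < f i)" for k
  have g: "g k < l \<and> h k < f (g k)" if "k < j" for k
    unfolding g_def by (rule LeastI_ex) (use f(3) h that in blast)
  obtain b where b: "b < l" "\<forall>k<j. g k < b"
    using l_bounded_family[OF j, of g] g by blast
  have "h k < f b" if "k < j" for k
    using g[OF that] b that strict_mono_onD[OF f(1), of "g k" b] by auto
  then show ?thesis
    using b f(2) by blast
qed

text \<open>
  A sequence in \<open>C\<close> that converges to \<open>a\<close> may have repetitions; the recursion thins it out, and the
  previous lemma keeps it below \<open>a\<close>.
\<close>

lemma l_closed_cofinal:
  assumes C: "l_closed l C" and a: "a \<in> lim_points" "cofinal_in C a"
  shows "a \<in> C"
proof -
  obtain f where f: "strict_mono_on {..<l} f" "\<And>i. i < l \<Longrightarrow> f i < a" "\<And>b. b < a \<Longrightarrow> \<exists>i<l. b < f i"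
    using a(1) lim_pointsD by blast
  have "\<exists>h. \<forall>i. i < l \<longrightarrow> h i \<in> C \<and> f i < h i \<and> h i < a \<and> (\<forall>k<i. h k < h i)"
  proof (rule dependent_wellorder_choice)
    fix i h
    assume IH: "\<And>k. k < i \<Longrightarrow> k < l \<longrightarrow> h k \<in> C \<and> f k < h k \<and> h k < a \<and> (\<forall>k'<k. h k' < h k)"
    show "\<exists>r. i < l \<longrightarrow> r \<in> C \<and> f i < r \<and> r < a \<and> (\<forall>k<i. h k < r)"
    proof (cases "i < l")
      case True
      have "\<And>k. k < i \<Longrightarrow> h k < a"
        using IH True less_trans by blast
      then obtain b where b: "b < a" "\<forall>k<i. h k < b"
        using lim_points_bound[OF a(1) True] by blast
      have "max b (f i) < a"
        using b f(2)[OF True] by simp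
      then obtain r where "r \<in> C" "max b (f i) < r" "r < a"
        using a(2) unfolding cofinal_in_def by blast
      then show ?thesis
        using b by (auto intro!: exI[of _ r] intro: less_trans)
    qed simp
  qed simp
  then obtain h where h: "\<And>i. i < l \<Longrightarrow> h i \<in> C \<and> f i < h i \<and> h i < a \<and> (\<forall>k<i. h k < h i)"
    by blast
  have "seq_sup l h = a"
  proof (rule seq_sup_eqI)
    show "h i \<le> a" if "i < l" for i
      using h that less_imp_le by blast
    show "\<exists>i<l. b < h i" if "b < a" for b
      using f(3)[OF that] h less_trans by blast
  qed
  moreover have "strict_mono_on {..<l} h"
    using h by (auto simp: strict_mono_on_def)
  ultimately show ?thesis
    using C h unfolding l_closed_def by metis
qed

text \<open>
  Diagonal intersection. The sets \<open>C x\<close> need not be closed, as being a limit of them is closed.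
\<close>

lemma diagonal_cub:
  fixes C :: "'k \<Rightarrow> 'k set"
  assumes "\<And>x. \<not> bdd_above (C x)"
  shows "l_cub l {a \<in> lim_points. \<forall>x<a. cofinal_in (C x) a}"
  unfolding l_cub_def
proof
  let ?K = "{a \<in> lim_points. \<forall>x<a. cofinal_in (C x) a}"
  show "l_closed l ?K"
    unfolding l_closed_def
  proof (intro allI impI, elim conjE)
    fix f assume f: "strict_mono_on {..<l} f" "\<forall>i<l. f i \<in> ?K"
    have "cofinal_in (C x) (seq_sup l f)" if x: "x < seq_sup l f" for x
      unfolding cofinal_in_def
    proof (intro allI impI)
      fix b assume "b < seq_sup l f"
      then obtain i where i: "i < l" "max x b < f i"
        using x seq_sup_approx[of "max x b" f] by auto
      then have "cofinal_in (C x) (f i)"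
        using f(2) by auto
      then obtain c where "c \<in> C x" "b < c" "c < f i"
        using i unfolding cofinal_in_def by auto
      then show "\<exists>c\<in>C x. b < c \<and> c < seq_sup l f"
        using less_seq_sup[OF f(1) i(1)] by (meson less_trans)
    qed
    then show "seq_sup l f \<in> ?K"
      using f(1) by (auto simp: lim_points_def)
  qed
  show "\<not> bdd_above ?K"
    unfolding not_bdd_iff
  proof
    fix b0
    have "\<exists>g. \<forall>i::'k. b0 < g i \<and> (\<forall>k<i. g k < g i \<and> (\<forall>x\<le>g k. \<exists>c\<in>C x. g k < c \<and> c < g i))"
    proof (rule dependent_wellorder_choice)
      fix i and g :: "'k \<Rightarrow> 'k"
      (* m k x is the next point of C x above g k; the new value has to exceed all of these. *)
      define m where "m k x = (LEAST c. c \<in> C x \<and> g k < c)" for k x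
      have m: "m k x \<in> C x \<and> g k < m k x" for k x
        unfolding m_def by (rule LeastI_ex) (use assms in \<open>auto simp: not_bdd_iff\<close>)
      have "\<forall>k. \<exists>d. \<forall>x\<le>g k. m k x < d"
        using bounded_family_le by blast
      then obtain d where d: "\<And>k x. x \<le> g k \<Longrightarrow> m k x < d k"
        by metis
      obtain b where b: "\<forall>k<i. d k < b"
        using bounded_family by blast
      obtain b' where b': "\<forall>k<i. g k < b'"
        using bounded_family by blast
      obtain r where "max b b' < r" "b0 < r"
        using ex_greater2 by blast
      then have "b0 < r \<and> (\<forall>k<i. g k < r \<and> (\<forall>x\<le>g k. \<exists>c\<in>C x. g k < c \<and> c < r))"
        using m d b b' by (meson less_trans max_less_iff_conj)
      then show "\<exists>r. b0 < r \<and> (\<forall>k<i. g k < r \<and> (\<forall>x\<le>g k. \<exists>c\<in>C x. g k < c \<and> c < r))"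
        by blast
    qed simp
    then obtain g :: "'k \<Rightarrow> 'k" where g: "\<And>i. b0 < g i"
      "\<And>i k. k < i \<Longrightarrow> g k < g i"
      "\<And>i k x. k < i \<Longrightarrow> x \<le> g k \<Longrightarrow> \<exists>c\<in>C x. g k < c \<and> c < g i"
      by blast
    let ?a = "seq_sup l g"
    have sm: "strict_mono_on {..<l} g"
      using g(2) by (auto simp: strict_mono_on_def)
    have "cofinal_in (C x) ?a" if x: "x < ?a" for x
      unfolding cofinal_in_def
    proof (intro allI impI)
      fix b assume "b < ?a"
      then obtain i where i: "i < l" "max x b < g i"
        using x seq_sup_approx[of "max x b" g] by auto
      obtain j where j: "i < j" "j < l"
        using l_limit i by blast
      then obtain c where "c \<in> C x" "g i < c" "c < g j"
        using g(3)[of i j x] i less_imp_le[of x "g i"] by auto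
      then show "\<exists>c\<in>C x. b < c \<and> c < ?a"
        using i less_seq_sup[OF sm j(2)] by (meson less_trans max_less_iff_conj)
    qed
    then have "?a \<in> ?K"
      using sm by (auto simp: lim_points_def)
    moreover have "b0 < ?a"
      using g(1) less_seq_sup[OF sm] l_pos less_trans by blast
    ultimately show "\<exists>c\<in>?K. b0 < c"
      by blast
  qed
qed

lemma stationary_diagonal:
  assumes "l_stationary l S" "\<And>x. \<not> bdd_above (C x)"
  obtains a where "a \<in> S" "a \<in> lim_points" "b < a" "\<And>x. x < a \<Longrightarrow> cofinal_in (C x) a"
proof -
  let ?C = "\<lambda>x. C x \<inter> {b<..}"
  have "\<not> bdd_above (?C x)" for x
    unfolding not_bdd_iff
  proof
    fix y
    obtain c where "c \<in> C x" "max b y < c"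
      using assms(2)[of x] unfolding not_bdd_iff by blast
    then show "\<exists>c\<in>?C x. y < c"
      by auto
  qed
  then have "S \<inter> {a \<in> lim_points. \<forall>x<a. cofinal_in (?C x) a} \<noteq> {}"
    using assms(1) diagonal_cub[of ?C] unfolding l_stationary_def by simp
  then obtain a where a: "a \<in> S" "a \<in> lim_points" "\<And>x. x < a \<Longrightarrow> cofinal_in (?C x) a"
    by blast
  obtain x where "x < a"
    using a(2) lim_points_less by blast
  then have "b < a"
    using a(3)[of x] unfolding cofinal_in_def by (meson IntE greaterThan_iff less_trans)
  moreover have "cofinal_in (C x) a" if "x < a" for x
    using a(3)[OF that] unfolding cofinal_in_def by blast
  ultimately show ?thesis
    using that a by blast
qed

lemma stationary_mono: "l_stationary l S \<Longrightarrow> S \<subseteq> S' \<Longrightarrow> l_stationary l S'"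
  unfolding l_stationary_def by blast

lemma l_cub_cofinal:
  "l_cub l C \<Longrightarrow> a \<in> lim_points \<Longrightarrow> cofinal_in C a \<Longrightarrow> a \<in> C"
  using l_closed_cofinal by (auto simp: l_cub_def)

text \<open>Being non-stationary is preserved by unions, and only limit points count.\<close>

lemma stationary_split_cases:
  assumes "l_stationary l S"
  shows "l_stationary l (S \<inter> lim_points \<inter> A) \<or> l_stationary l (S \<inter> lim_points - A)"
proof (rule ccontr)
  assume "\<not> ?thesis"
  then obtain C1 C2 where C: "l_cub l C1" "S \<inter> lim_points \<inter> A \<inter> C1 = {}"
      "l_cub l C2" "(S \<inter> lim_points - A) \<inter> C2 = {}"
    unfolding l_stationary_def by blast
  (* The diagonal intersection of a family that takes both values below l0. *)
  obtain l0 where l0: "l < l0"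
    using ex_greater by blast
  let ?C = "\<lambda>x. if x = l then C1 else C2"
  have "\<not> bdd_above (?C x)" for x
    using C by (simp add: l_cub_def)
  then obtain a where a: "a \<in> S" "a \<in> lim_points" "l0 < a" "\<And>x. x < a \<Longrightarrow> cofinal_in (?C x) a"
    using stationary_diagonal[OF assms, of ?C] by metis
  have "cofinal_in C1 a" "cofinal_in C2 a"
    using a(4)[of l] a(4)[of l0] l0 a(3) by (auto split: if_splits)
  then have "a \<in> C1" "a \<in> C2"
    using C a l_cub_cofinal by blast+
  then show False
    using C a by blast
qed

text \<open>
  If for each \<open>v\<close> a cub set \<open>C v\<close> misses the points with value \<open>v\<close>, then a point \<open>a\<close> of \<open>S\<close> in the
  diagonal intersection belongs to \<open>C (g a)\<close>.
\<close>

lemma Fodor: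
  assumes S: "l_stationary l S" and g: "\<And>a. a \<in> S \<Longrightarrow> a \<in> lim_points \<Longrightarrow> g a < a"
  shows "\<exists>v. l_stationary l {a \<in> S \<inter> lim_points. g a = v}"
proof (rule ccontr)
  assume "\<not> ?thesis"
  then have "\<exists>C. l_cub l C \<and> {a \<in> S \<inter> lim_points. g a = v} \<inter> C = {}" for v
    unfolding l_stationary_def by blast
  then obtain C where C: "\<And>v. l_cub l (C v)" "\<And>v. {a \<in> S \<inter> lim_points. g a = v} \<inter> C v = {}"
    by metis
  have "\<And>v. \<not> bdd_above (C v)"
    using C(1) by (simp add: l_cub_def)
  then obtain a where a: "a \<in> S" "a \<in> lim_points" "\<And>x. x < a \<Longrightarrow> cofinal_in (C x) a"
    using stationary_diagonal[OF S, of C] by metis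
  have "a \<in> C (g a)"
    using a g C(1) l_cub_cofinal by blast
  then show False
    using a C(2)[of "g a"] by auto
qed

lemma stationary_UNIV: "l_stationary l UNIV"
  unfolding l_stationary_def l_cub_def by auto

text \<open>
  Choose a sequence converging to each limit point. If for each \<open>i < \<lambda>\<close> the \<open>i\<close>-th terms were
  bounded by a constant on a cub set, then a limit point in all of these \<open>\<lambda>\<close> cub sets and above all
  the bounds would not be the supremum of its sequence. So for some \<open>i\<close> the \<open>i\<close>-th term is a
  regressive function that is unbounded on every cub set, and Fodor's lemma yields two different
  values that it takes on stationary sets.
\<close>

lemma stationary_splitting:
  "\<exists>A \<subseteq> lim_points. l_stationary l A \<and> l_stationary l (lim_points - A)"
proof -
  have "\<forall>a. \<exists>f. a \<in> lim_points \<longrightarrow> (\<forall>i<l. f i < a) \<and> (\<forall>b<a. \<exists>i<l. b < f i)"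
    using lim_pointsD by blast
  then obtain f where f: "\<And>a i. a \<in> lim_points \<Longrightarrow> i < l \<Longrightarrow> f a i < a"
      "\<And>a b. a \<in> lim_points \<Longrightarrow> b < a \<Longrightarrow> \<exists>i<l. b < f a i"
    by metis
  have "\<exists>i<l. \<forall>e. l_stationary l {a \<in> lim_points. e \<le> f a i}"
  proof (rule ccontr)
    assume "\<not> ?thesis"
    then have "\<forall>i. \<exists>e C. i < l \<longrightarrow> l_cub l C \<and> {a \<in> lim_points. e \<le> f a i} \<inter> C = {}"
      unfolding l_stationary_def by blast
    then obtain e C where eC: "\<And>i. i < l \<Longrightarrow> l_cub l (C i)"
        "\<And>i. i < l \<Longrightarrow> {a \<in> lim_points. e i \<le> f a i} \<inter> C i = {}"
      by metis
    obtain b where b: "\<forall>i<l. e i < b"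
      using bounded_family by blast
    let ?C = "\<lambda>i. if i < l then C i else UNIV"
    have "\<not> bdd_above (?C i)" for i
      using eC(1)[of i] unbounded_UNIV by (simp add: l_cub_def)
    then obtain a where a: "a \<in> lim_points" "b < a" "\<And>i. i < a \<Longrightarrow> cofinal_in (?C i) a"
      using stationary_diagonal[OF stationary_UNIV, of ?C] by metis
    have "f a i \<le> b" if i: "i < l" for i
    proof -
      have "cofinal_in (C i) a"
        using a(3)[of i] i lim_points_ge[OF a(1)] by auto
      then have "a \<in> C i"
        using eC(1) i a(1) l_cub_cofinal by blast
      then have "f a i < e i"
        using eC(2)[OF i] a(1) by (auto simp: not_le)
      then show ?thesis
        using b i by (meson less_imp_le less_trans)
    qed
    then show False
      using f(2)[OF a(1,2)] by (meson leD)
  qed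
  then obtain i where i: "i < l" "\<And>e. l_stationary l {a \<in> lim_points. e \<le> f a i}"
    by blast
  have val: "\<exists>v\<ge>e. l_stationary l {a \<in> lim_points. f a i = v}" for e
  proof -
    obtain v where v: "l_stationary l {a \<in> {a \<in> lim_points. e \<le> f a i} \<inter> lim_points. f a i = v}"
      using Fodor[OF i(2)[of e], of "\<lambda>a. f a i"] f(1) i(1) by auto
    have "l_stationary l {a \<in> lim_points. f a i = v}"
      using v by (rule stationary_mono) auto
    moreover have "\<exists>a. f a i = v \<and> e \<le> f a i"
      using stationary_diagonal[OF v, of "\<lambda>_. UNIV"] unbounded_UNIV
      by (metis (mono_tags, lifting) IntD1 mem_Collect_eq)
    ultimately show ?thesis
      by blast
  qed
  obtain v where v: "l_stationary l {a \<in> lim_points. f a i = v}"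
    using val by blast
  obtain v' where v': "v < v'"
    using ex_greater by blast
  obtain w where w: "w \<ge> v'" "l_stationary l {a \<in> lim_points. f a i = w}"
    using val by blast
  have "l_stationary l (lim_points - {a \<in> lim_points. f a i = v})"
    using w(2) by (rule stationary_mono) (use v' w(1) in auto)
  then show ?thesis
    using v by (intro exI[of _ "{a \<in> lim_points. f a i = v}"]) auto
qed

end

section \<open>The generalized Cantor space\<close>

definition agree :: "'k::wellorder \<Rightarrow> ('k \<Rightarrow> 'v) \<Rightarrow> ('k \<Rightarrow> 'v) \<Rightarrow> bool" where
  "agree a x y \<longleftrightarrow> (\<forall>b<a. x b = y b)"

lemma agree_refl [simp]: "agree a x x"
  by (simp add: agree_def)

lemma agree_sym: "agree a x y \<Longrightarrow> agree a y x"
  by (simp add: agree_def)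

lemma agree_trans: "agree a x y \<Longrightarrow> agree a y z \<Longrightarrow> agree a x z"
  by (simp add: agree_def)

lemma agree_mono: "agree b x y \<Longrightarrow> a \<le> b \<Longrightarrow> agree a x y"
  by (meson agree_def order.strict_trans2)

lemma agreeD: "agree a x y \<Longrightarrow> b < a \<Longrightarrow> x b = y b"
  by (simp add: agree_def)

lemma basic_nbhd_agree: "basic_nbhd a p = {x. agree a p x}"
  by (auto simp: basic_nbhd_def agree_def)

lemma topspace_cantor [simp]: "topspace cantor_top = (UNIV :: ('k::wellorder \<Rightarrow> bool) set)"
proof -
  have "x \<in> topspace cantor_top" for x :: "'k \<Rightarrow> bool"
  proof -
    have "x \<in> basic_nbhd undefined x"
      by (simp add: basic_nbhd_agree)
    then show ?thesis
      unfolding cantor_top_def topology_generated_by_topspace by blast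
  qed
  then show ?thesis
    by auto
qed

lemma openin_cantor_iff:
  "openin cantor_top U \<longleftrightarrow> (\<forall>x\<in>U. \<exists>a. \<forall>y. agree a x y \<longrightarrow> y \<in> U)"
proof
  assume "openin cantor_top U"
  then have "generate_topology_on {basic_nbhd a p |a p. True} U"
    by (simp add: cantor_top_def openin_topology_generated_by_iff)
  then show "\<forall>x\<in>U. \<exists>a. \<forall>y. agree a x y \<longrightarrow> y \<in> U"
  proof induction
    case (Int A B)
    show ?case
    proof
      fix x assume "x \<in> A \<inter> B"
      then obtain a b where "\<forall>y. agree a x y \<longrightarrow> y \<in> A" "\<forall>y. agree b x y \<longrightarrow> y \<in> B"
        using Int.IH by blast
      then show "\<exists>a. \<forall>y. agree a x y \<longrightarrow> y \<in> A \<inter> B"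
        using agree_mono[of "max a b" x _ a] agree_mono[of "max a b" x _ b]
        by (intro exI[of _ "max a b"]) auto
    qed
  next
    case (UN K)
    show ?case
    proof
      fix x assume "x \<in> \<Union>K"
      then obtain k where k: "k \<in> K" "x \<in> k"
        by blast
      then obtain a where "\<forall>y. agree a x y \<longrightarrow> y \<in> k"
        using UN.IH by blast
      then show "\<exists>a. \<forall>y. agree a x y \<longrightarrow> y \<in> \<Union>K"
        using k(1) by blast
    qed
  next
    case (Basis s)
    then show ?case
      by (auto simp: basic_nbhd_agree intro: agree_trans)
  qed auto
next
  assume U: "\<forall>x\<in>U. \<exists>a. \<forall>y. agree a x y \<longrightarrow> y \<in> U"
  have "openin cantor_top (basic_nbhd a p)" for a and p :: "'a \<Rightarrow> bool"
    unfolding cantor_top_def by (rule topology_generated_by_Basis) blast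
  moreover have "\<exists>T. openin cantor_top T \<and> x \<in> T \<and> T \<subseteq> U" if x: "x \<in> U" for x
  proof -
    obtain a where "\<forall>y. agree a x y \<longrightarrow> y \<in> U"
      using U x by auto
    then have "x \<in> basic_nbhd a x" "basic_nbhd a x \<subseteq> U"
      by (auto simp: basic_nbhd_agree)
    then show ?thesis
      using \<open>\<And>p a. openin cantor_top (basic_nbhd a p)\<close> by blast
  qed
  ultimately show "openin cantor_top U"
    by (subst openin_subopen) simp
qed

lemma openin_cantorI: "(\<And>x. x \<in> U \<Longrightarrow> \<exists>a. \<forall>y. agree a x y \<longrightarrow> y \<in> U) \<Longrightarrow> openin cantor_top U"
  by (simp add: openin_cantor_iff)

lemma openin_prodI:
  assumes "\<And>x y. (x, y) \<in> W \<Longrightarrow> \<exists>a. \<forall>x' y'. agree a x x' \<longrightarrow> agree a y y' \<longrightarrow> (x', y') \<in> W"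
  shows "openin (prod_topology cantor_top cantor_top) W"
  unfolding openin_prod_topology_alt
proof (intro allI impI)
  fix x y assume "(x, y) \<in> W"
  then obtain a where a: "\<forall>x' y'. agree a x x' \<longrightarrow> agree a y y' \<longrightarrow> (x', y') \<in> W"
    using assms by blast
  have "openin cantor_top {z. agree a x z}" for x
    by (rule openin_cantorI) (use agree_trans[of a x] in blast)
  then show "\<exists>U V. openin cantor_top U \<and> openin cantor_top V \<and> x \<in> U \<and> y \<in> V \<and> U \<times> V \<subseteq> W"
    using a by (intro exI[of _ "{z. agree a x z}"] exI[of _ "{z. agree a y z}"]) auto
qed

lemma borel_UN:
  fixes A :: "'k::wellorder \<Rightarrow> 'c set"
  assumes "\<And>i. A i \<in> borel_of_length (kappa :: 'k rel) T"
  shows "(\<Union>i. A i) \<in> borel_of_length (kappa :: 'k rel) T"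
  by (rule borel_of_length.union[OF range_ordLeq_kappa]) (use assms in auto)

lemma borel_INT:
  fixes A :: "'k::wellorder \<Rightarrow> 'c set"
  assumes "\<And>i. A i \<in> borel_of_length (kappa :: 'k rel) T"
  shows "(\<Inter>i. A i) \<in> borel_of_length (kappa :: 'k rel) T"
  by (rule borel_of_length.intersection[OF _ range_ordLeq_kappa]) (use assms in auto)

context regular_pair
begin

text \<open>
  A uniform form of continuity that all the reductions below have: every bit of the image depends on
  a fixed initial segment of the argument.
\<close>

definition local_map :: "(('k \<Rightarrow> bool) \<Rightarrow> ('k \<Rightarrow> bool)) \<Rightarrow> bool" where
  "local_map f \<longleftrightarrow> (\<forall>b. \<exists>a. \<forall>x y. agree a x y \<longrightarrow> f x b = f y b)"

lemma local_mapD: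
  assumes "local_map f"
  shows "\<exists>a. \<forall>x y. agree a x y \<longrightarrow> agree b (f x) (f y)"
proof -
  obtain m where m: "\<And>c x y. agree (m c) x y \<Longrightarrow> f x c = f y c"
    using assms unfolding local_map_def by metis
  obtain a where "\<forall>c<b. m c < a"
    using bounded_family by blast
  then have "agree b (f x) (f y)" if "agree a x y" for x y
    using m[OF agree_mono[OF that]] by (auto simp: agree_def[of b] less_imp_le)
  then show ?thesis
    by blast
qed

lemma local_map_borel: "local_map f \<Longrightarrow> borel_function f"
  unfolding borel_function_def
proof (intro allI impI borel_of_length.open_set openin_cantorI)
  fix U and x :: "'k \<Rightarrow> bool" 
  assume f: "local_map f" and "openin cantor_top U" "x \<in> f -` U"
  then obtain b where b: "\<forall>y. agree b (f x) y \<longrightarrow> y \<in> U"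
    by (auto simp: openin_cantor_iff)
  obtain a where "\<forall>x y. agree a x y \<longrightarrow> agree b (f x) (f y)"
    using local_mapD[OF f] by blast
  then show "\<exists>a. \<forall>y. agree a x y \<longrightarrow> y \<in> f -` U"
    using b by (intro exI[of _ a]) simp
qed

lemma kernel_borel:
  assumes "local_map f"
  shows "{(x, y). f x = f y} \<in> borel_of_length (kappa :: 'k rel) (prod_topology cantor_top cantor_top)"
proof -
  have "{(x, y). f x b = f y b} \<in> borel_of_length (kappa :: 'k rel) (prod_topology cantor_top cantor_top)" for b
  proof (rule borel_of_length.open_set, rule openin_prodI)
    fix x y assume xy: "(x, y) \<in> {(x, y). f x b = f y b}"
    obtain a where a: "\<And>x y. agree a x y \<Longrightarrow> f x b = f y b"
      using assms unfolding local_map_def by blast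
    show "\<exists>a. \<forall>x' y'. agree a x x' \<longrightarrow> agree a y y' \<longrightarrow> (x', y') \<in> {(x, y). f x b = f y b}"
      using xy a[of x] a[of y] by (intro exI[of _ a]) auto
  qed
  then have "(\<Inter>b. {(x, y). f x b = f y b}) \<in> borel_of_length (kappa :: 'k rel) (prod_topology cantor_top cantor_top)"
    by (rule borel_INT)
  moreover have "(\<Inter>b. {(x, y). f x b = f y b}) = {(x, y). f x = f y}"
    by auto
  ultimately show ?thesis
    by simp
qed

lemma E0_iff: "(x, y) \<in> E0 \<longleftrightarrow> (\<exists>a. \<forall>b>a. x b = y (b :: 'k))"
  unfolding E0_def bdd_above_def using not_le by auto

lemma E0_borel: "(E0 :: ('k \<Rightarrow> bool) rel) \<in> borel_of_length (kappa :: 'k rel) (prod_topology cantor_top cantor_top)"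
proof -
  let ?W = "\<lambda>a b. {(x, y). a < b \<longrightarrow> x b = y (b :: 'k)} :: ('k \<Rightarrow> bool) rel"
  have "?W a b \<in> borel_of_length (kappa :: 'k rel) (prod_topology cantor_top cantor_top)" for a b
  proof (rule borel_of_length.open_set, rule openin_prodI)
    fix x y assume xy: "(x, y) \<in> ?W a b"
    obtain c where "b < c"
      using ex_greater by blast
    then show "\<exists>c. \<forall>x' y'. agree c x x' \<longrightarrow> agree c y y' \<longrightarrow> (x', y') \<in> ?W a b"
      using xy by (intro exI[of _ c]) (auto simp: agree_def)
  qed
  then have "(\<Union>a. \<Inter>b. ?W a b) \<in> borel_of_length (kappa :: 'k rel) (prod_topology cantor_top cantor_top)"
    by (intro borel_UN borel_INT)
  moreover have "E0 = (\<Union>a. \<Inter>b. ?W a b)"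
    by (simp add: E0_iff set_eq_iff)
  ultimately show ?thesis
    by simp
qed

lemma equiv_E0: "equiv UNIV (E0 :: ('k \<Rightarrow> bool) rel)"
proof (rule equivI)
  show "trans (E0 :: ('k \<Rightarrow> bool) rel)"
  proof (rule transI)
    fix x y z :: "'k \<Rightarrow> bool" assume "(x, y) \<in> E0" "(y, z) \<in> E0"
    then obtain a a' where "\<forall>b>a. x b = y b" "\<forall>b>a'. y b = z b"
      unfolding E0_iff by blast
    then show "(x, z) \<in> E0"
      unfolding E0_iff by (intro exI[of _ "max a a'"]) auto
  qed
  show "refl_on UNIV (E0 :: ('k \<Rightarrow> bool) rel)"
    by (simp add: refl_on_def E0_iff)
  show "sym (E0 :: ('k \<Rightarrow> bool) rel)"
    by (rule symI) (metis E0_iff)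
qed simp

section \<open>Category\<close>

definition dense_open :: "('k \<Rightarrow> bool) set \<Rightarrow> bool" where
  "dense_open U \<longleftrightarrow> openin cantor_top U \<and> (\<forall>a p. \<exists>x\<in>U. agree a p x)"

definition comeager :: "('k \<Rightarrow> bool) set \<Rightarrow> bool" where
  "comeager C \<longleftrightarrow> (\<exists>U :: 'k \<Rightarrow> ('k \<Rightarrow> bool) set. (\<forall>i. dense_open (U i)) \<and> (\<Inter>i. U i) \<subseteq> C)"

lemma comeager_mono: "comeager C \<Longrightarrow> C \<subseteq> C' \<Longrightarrow> comeager C'"
  unfolding comeager_def by blast

lemma dense_open_comeager: "dense_open U \<Longrightarrow> comeager U"
  unfolding comeager_def by (intro exI[of _ "\<lambda>_. U"]) simp

lemma comeager_INT:
  fixes C :: "'k \<Rightarrow> ('k \<Rightarrow> bool) set"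
  assumes "\<And>i. comeager (C i)"
  shows "comeager (\<Inter>i. C i)"
proof -
  obtain U :: "'k \<Rightarrow> 'k \<Rightarrow> ('k \<Rightarrow> bool) set"
    where U: "\<And>i j. dense_open (U i j)" "\<And>i. (\<Inter>j. U i j) \<subseteq> C i"
    using assms unfolding comeager_def by metis
  have "x \<in> C i" if "\<forall>a. x \<in> U (arg1 a) (arg2 a)" for x i
  proof -
    have "x \<in> U i j" for j
      using that[rule_format, of "pos 0 i j"] by simp
    then show ?thesis
      using U(2)[of i] by auto
  qed
  then have "(\<Inter>a. U (arg1 a) (arg2 a)) \<subseteq> (\<Inter>i. C i)"
    by auto
  then show ?thesis
    unfolding comeager_def using U(1) by (intro exI[of _ "\<lambda>a. U (arg1 a) (arg2 a)"]) simp
qed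

lemma comeager_Int:
  assumes "comeager C" "comeager D"
  shows "comeager (C \<inter> D)"
proof -
  have "comeager (\<Inter>i. if i = l then C else D)"
    using assms by (intro comeager_INT) auto
  moreover obtain i where "l < i"
    using ex_greater by blast
  then have "(\<Inter>i. if i = l then C else D) \<subseteq> (if l = l then C else D) \<inter> (if i = l then C else D)"
    by blast
  then have "(\<Inter>i. if i = l then C else D) \<subseteq> C \<inter> D"
    using \<open>l < i\<close> by (simp only: refl if_True less_imp_neq[THEN not_sym] if_False)
  ultimately show ?thesis
    by (rule comeager_mono)
qed

definition exterior :: "('k \<Rightarrow> bool) set \<Rightarrow> ('k \<Rightarrow> bool) set" where
  "exterior V = {x. \<exists>a. \<forall>y. agree a x y \<longrightarrow> y \<notin> V}"

lemma openin_exterior: "openin cantor_top (exterior V)"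
proof (rule openin_cantorI)
  fix x assume "x \<in> exterior V"
  then obtain a where "\<And>y. agree a x y \<Longrightarrow> y \<notin> V"
    by (auto simp: exterior_def)
  then have "y \<in> exterior V" if "agree a x y" for y
    using agree_trans[OF that] unfolding exterior_def by blast
  then show "\<exists>a. \<forall>y. agree a x y \<longrightarrow> y \<in> exterior V"
    by blast
qed

lemma exterior_disjoint: "V \<inter> exterior V = {}"
  using agree_refl by (auto simp: exterior_def)

lemma dense_open_exterior: "openin cantor_top V \<Longrightarrow> dense_open (V \<union> exterior V)"
  unfolding dense_open_def
proof (intro conjI allI)
  show "\<exists>x\<in>V \<union> exterior V. agree a p x" for a p
  proof (cases "\<exists>x\<in>V. agree a p x")
    case False
    then have "p \<in> exterior V"
      by (auto simp: exterior_def)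
    then show ?thesis
      by (intro bexI[of _ p]) simp_all
  qed auto
qed (simp add: openin_Un openin_exterior)

definition baire :: "('k \<Rightarrow> bool) set \<Rightarrow> bool" where
  "baire A \<longleftrightarrow> (\<exists>V. openin cantor_top V \<and> comeager {x. x \<in> A \<longleftrightarrow> x \<in> V})"

text \<open>On a comeager set, the complement of \<open>V\<close> is the exterior of \<open>V\<close>.\<close>

lemma baire_complement:
  assumes "baire A"
  shows "baire (- A)"
proof -
  obtain V where V: "openin cantor_top V" "comeager {x. x \<in> A \<longleftrightarrow> x \<in> V}"
    using assms baire_def by blast
  have "comeager ({x. x \<in> A \<longleftrightarrow> x \<in> V} \<inter> (V \<union> exterior V))"
    using V dense_open_exterior dense_open_comeager comeager_Int by blast
  then have "comeager {x. x \<in> - A \<longleftrightarrow> x \<in> exterior V}"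
    by (rule comeager_mono) (use exterior_disjoint in blast)
  then show ?thesis
    using openin_exterior baire_def by blast
qed

lemma baire_UN:
  fixes A :: "'k \<Rightarrow> ('k \<Rightarrow> bool) set"
  assumes "\<And>i. baire (A i)"
  shows "baire (\<Union>i. A i)"
proof -
  obtain V where V: "\<And>i. openin cantor_top (V i)" "\<And>i. comeager {x. x \<in> A i \<longleftrightarrow> x \<in> V i}"
    using assms unfolding baire_def by metis
  have "comeager {x. x \<in> (\<Union>i. A i) \<longleftrightarrow> x \<in> (\<Union>i. V i)}"
    using comeager_INT[OF V(2)] by (rule comeager_mono) auto
  moreover have "openin cantor_top (\<Union>i. V i)"
    by (rule openin_Union) (use V(1) in auto)
  ultimately show ?thesis
    unfolding baire_def by (intro exI[of _ "\<Union>i. V i"]) simp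
qed

lemma borel_baire:
  assumes "A \<in> borel_of_length (kappa :: 'k rel) cantor_top"
  shows "baire A"
  using assms
proof induction
  case (open_set U)
  have "comeager (U \<union> exterior U)"
    using open_set dense_open_exterior dense_open_comeager by simp
  then have "comeager {x. x \<in> U \<longleftrightarrow> x \<in> U}"
    by (rule comeager_mono) simp
  then show ?case
    unfolding baire_def using open_set by (intro exI[of _ U]) simp
next
  case (complement A)
  then show ?case
    using baire_complement by (simp add: Compl_eq_Diff_UNIV)
next
  case (union S)
  show ?case
  proof (cases "S = {}")
    case True
    have "dense_open ({} \<union> exterior {})"
      by (rule dense_open_exterior) simp
    then have "comeager {x. x \<in> {} \<longleftrightarrow> x \<in> ({} :: ('k \<Rightarrow> bool) set)}"
      by (rule comeager_mono[OF dense_open_comeager]) simp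
    then have "baire ({} :: ('k \<Rightarrow> bool) set)"
      unfolding baire_def by (intro exI[of _ "{}"]) simp
    then show ?thesis
      using True by simp
  next
    case False
    obtain e :: "'k \<Rightarrow> _" where e: "S = range e"
      using ordLeq_kappa_enumeration[OF union(1) False] by (elim exE)
    have "baire (e i)" for i
      using union.IH[of "e i"] e by simp
    then show ?thesis
      using baire_UN e by simp
  qed
next
  case (intersection S)
  then obtain e :: "'k \<Rightarrow> _" where e: "S = range e"
    using ordLeq_kappa_enumeration[OF intersection(2,1)] by (elim exE)
  have "baire (e i)" for i
    using intersection.IH[of "e i"] e by simp
  then have "baire (- (\<Union>i. - e i))"
    by (intro baire_complement baire_UN)
  then show ?case
    using e by simp
qed

text \<open>
  What happens at the limit stages of the constructions below; each \<open>s i\<close> is an initial segment, given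
  by its length and a function that matters below this length only.
\<close>

lemma glue:
  fixes s :: "'i \<Rightarrow> 'k \<times> ('k \<Rightarrow> 'v)"
  assumes "\<And>i j. i \<in> I \<Longrightarrow> j \<in> I \<Longrightarrow> agree (min (fst (s i)) (fst (s j))) (snd (s i)) (snd (s j))"
  shows "\<exists>z. \<forall>i\<in>I. agree (fst (s i)) (snd (s i)) z"
proof -
  let ?j = "\<lambda>b. SOME j. j \<in> I \<and> b < fst (s j)"
  have "agree (fst (s i)) (snd (s i)) (\<lambda>b. snd (s (?j b)) b)" if "i \<in> I" for i
    unfolding agree_def
  proof (intro allI impI)
    fix b assume b: "b < fst (s i)"
    then have "?j b \<in> I \<and> b < fst (s (?j b))"
      using that by (intro someI[of "\<lambda>j. j \<in> I \<and> b < fst (s j)" i]) simp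
    then show "snd (s i) b = snd (s (?j b)) b"
      using assms[of i "?j b"] that b by (auto simp: agree_def)
  qed
  then show ?thesis
    by blast
qed

text \<open>
  A sequence of conditions \<open>(a, p)\<close> of length \<open>\<kappa>\<close>, each extending the previous ones and the \<open>i\<close>-th
  one forcing the \<open>i\<close>-th dense open set.
\<close>

lemma baire_category:
  assumes "comeager C"
  shows "\<exists>x\<in>C. agree a0 p0 x"
proof -
  obtain U :: "'k \<Rightarrow> ('k \<Rightarrow> bool) set" where U: "\<And>i. dense_open (U i)" "(\<Inter>i. U i) \<subseteq> C"
    using assms unfolding comeager_def by blast
  define P where "P s i r \<longleftrightarrow> a0 \<le> fst r \<and> agree a0 p0 (snd r) \<and>
      (\<forall>k<i. fst (s k) \<le> fst r \<and> agree (fst (s k)) (snd (s k)) (snd r)) \<and>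
      (\<forall>y. agree (fst r) (snd r) y \<longrightarrow> y \<in> U i)"
    for s :: "'k \<Rightarrow> 'k \<times> ('k \<Rightarrow> bool)" and i r
  have "\<exists>s. \<forall>i. P s i (s i)"
  proof (rule dependent_wellorder_choice)
    fix s i assume IH: "\<And>k. k < i \<Longrightarrow> P s k (s k)"
    have mono: "fst (s k) \<le> fst (s k') \<and> agree (fst (s k)) (snd (s k)) (snd (s k'))"
      if "k \<le> k'" "k' < i" for k k'
      using IH[OF that(2)] that(1) unfolding P_def by (cases "k = k'") auto
    have "agree (min (fst (s k)) (fst (s k'))) (snd (s k)) (snd (s k'))" if "k < i" "k' < i" for k k'
      using mono[of k k'] mono[of k' k] that by (cases "k \<le> k'") (auto simp: min_absorb1 min_absorb2 intro: agree_sym)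
    then obtain z where z: "\<forall>k\<in>{..<i}. agree (fst (s k)) (snd (s k)) z"
      using glue[of "{..<i}" s] by auto
    obtain b where b: "\<forall>k<i. fst (s k) < b"
      using bounded_family[of i "\<lambda>k. fst (s k)"] by blast
    (* At the first stage nothing is glued, and the given p0 takes over. *)
    define z0 where "z0 = (if \<exists>k. k < i then z else p0)"
    have z0: "agree a0 p0 z0" "\<And>k. k < i \<Longrightarrow> agree (fst (s k)) (snd (s k)) z0"
    proof -
      show "agree a0 p0 z0"
      proof (cases "\<exists>k. k < i")
        case True
        then obtain k where k: "k < i"
          by blast
        have "agree a0 p0 (snd (s k))" "a0 \<le> fst (s k)" "agree (fst (s k)) (snd (s k)) z"
          using IH[OF k] z k unfolding P_def by auto
        then have "agree a0 p0 z"
          using agree_trans agree_mono by blast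
        then show ?thesis
          using True by (simp add: z0_def)
      qed (simp add: z0_def)
      show "agree (fst (s k)) (snd (s k)) z0" if "k < i" for k
        using z that by (auto simp: z0_def)
    qed
    obtain x where x: "x \<in> U i" "agree (max a0 b) z0 x"
      using U(1)[of i] unfolding dense_open_def by blast
    then obtain c where c: "\<forall>y. agree c x y \<longrightarrow> y \<in> U i"
      using U(1)[of i] unfolding dense_open_def openin_cantor_iff by blast
    have "agree a0 z0 x"
      by (rule agree_mono[OF x(2)]) simp
    then have 1: "agree a0 p0 x"
      using z0(1) agree_trans by blast
    have 2: "fst (s k) \<le> max c (max a0 b)" "agree (fst (s k)) (snd (s k)) x" if "k < i" for k
    proof -
      have "fst (s k) \<le> max a0 b"
        using b that by (simp add: less_imp_le le_max_iff_disj)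
      then show "fst (s k) \<le> max c (max a0 b)" "agree (fst (s k)) (snd (s k)) x"
        using agree_trans[OF z0(2)[OF that] agree_mono[OF x(2)]] by (simp_all add: max.coboundedI2)
    qed
    have 3: "y \<in> U i" if "agree (max c (max a0 b)) x y" for y
      using c agree_mono[OF that, of c] by simp
    have "P s i (max c (max a0 b), x)"
      unfolding P_def using 1 2 3 by (simp add: max.coboundedI2)
    then show "\<exists>r. P s i r"
      by blast
  qed (simp add: P_def)
  then obtain s where s: "\<And>i. P s i (s i)"
    by blast
  have mono: "fst (s k) \<le> fst (s k') \<and> agree (fst (s k)) (snd (s k)) (snd (s k'))" if "k \<le> k'" for k k'
    using s[of k'] that unfolding P_def by (cases "k = k'") auto
  have "agree (min (fst (s k)) (fst (s k'))) (snd (s k)) (snd (s k'))" for k k'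
    using mono[of k k'] mono[of k' k] by (cases "k \<le> k'") (auto simp: min_absorb1 min_absorb2 intro: agree_sym)
  then obtain z where z: "\<And>k. agree (fst (s k)) (snd (s k)) z"
    using glue[of UNIV s] by auto
  have "z \<in> U i" for i
    using s[of i] z[of i] unfolding P_def by blast
  moreover have "agree a0 p0 z"
    using s[of l] agree_trans agree_mono[OF z[of l]] unfolding P_def by blast
  ultimately show ?thesis
    using U(2) by blast
qed

definition flip :: "'k set \<Rightarrow> ('k \<Rightarrow> bool) \<Rightarrow> ('k \<Rightarrow> bool)" where
  "flip D x = (\<lambda>a. x a \<noteq> (a \<in> D))"

lemma flip_flip [simp]: "flip D (flip D x) = x"
  by (auto simp: flip_def)

lemma agree_flip [simp]: "agree a (flip D x) (flip D y) \<longleftrightarrow> agree a x y"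
  by (auto simp: agree_def flip_def)

lemma comeager_flip:
  assumes "comeager C"
  shows "comeager {x. flip D x \<in> C}"
proof -
  obtain U :: "'k \<Rightarrow> ('k \<Rightarrow> bool) set" where U: "\<And>i. dense_open (U i)" "(\<Inter>i. U i) \<subseteq> C"
    using assms unfolding comeager_def by blast
  have "dense_open {x. flip D x \<in> U i}" for i
    unfolding dense_open_def
  proof (intro conjI allI)
    show "openin cantor_top {x. flip D x \<in> U i}"
    proof (rule openin_cantorI)
      fix x assume "x \<in> {x. flip D x \<in> U i}"
      then obtain a where "\<forall>y. agree a (flip D x) y \<longrightarrow> y \<in> U i"
        using U(1)[of i] unfolding dense_open_def openin_cantor_iff by blast
      then show "\<exists>a. \<forall>y. agree a x y \<longrightarrow> y \<in> {x. flip D x \<in> U i}"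
        by (intro exI[of _ a]) simp
    qed
    show "\<exists>x\<in>{x. flip D x \<in> U i}. agree a p x" for a p
    proof -
      obtain y where "y \<in> U i" "agree a (flip D p) y"
        using U(1)[of i] unfolding dense_open_def by blast
      then show ?thesis
        using agree_flip[of a D p "flip D y"] by (intro bexI[of _ "flip D y"]) auto
    qed
  qed
  then show ?thesis
    unfolding comeager_def using U(2) by (intro exI[of _ "\<lambda>i. {x. flip D x \<in> U i}"]) auto
qed

text \<open>
  Flipping a set of coordinates is a homeomorphism, so a generic point can be chosen such that its
  flips are generic as well.
\<close>

lemma generic_point:
  assumes "comeager C"
  shows "\<exists>x\<in>C. flip D x \<in> C \<and> flip D' x \<in> C \<and> agree a p x"
proof -
  have "comeager (C \<inter> ({x. flip D x \<in> C} \<inter> {x. flip D' x \<in> C}))"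
    using assms by (intro comeager_Int comeager_flip)
  then show ?thesis
    using baire_category[of _ a p] by blast
qed

text \<open>
  Each bit of \<open>f\<close> agrees with an open set, and its negation with another one, off a meager set; there
  are only \<open>\<kappa>\<close> bits.
\<close>

lemma continuous_on_comeager:
  assumes "borel_function f"
  shows "\<exists>C. comeager C \<and> (\<forall>x\<in>C. \<forall>b. \<exists>a. \<forall>y\<in>C. agree a x y \<longrightarrow> agree b (f x) (f y))"
proof -
  have B: "baire {x. f x b}" for b
  proof -
    have "openin cantor_top {y :: 'k \<Rightarrow> bool. y b}"
      using ex_greater[of b] by (intro openin_cantorI) (auto simp: agree_def)
    then have "f -` {y. y b} \<in> borel_of_length (kappa :: 'k rel) cantor_top"
      using assms unfolding borel_function_def by blast
    then show ?thesis
      using borel_baire by (simp add: vimage_def)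
  qed
  obtain V where V: "\<And>b. openin cantor_top (V b)" "\<And>b. comeager {x. x \<in> {x. f x b} \<longleftrightarrow> x \<in> V b}"
    using B unfolding baire_def by metis
  obtain W where W: "\<And>b. openin cantor_top (W b)" "\<And>b. comeager {x. x \<in> - {x. f x b} \<longleftrightarrow> x \<in> W b}"
    using baire_complement[OF B] unfolding baire_def by metis
  define C where "C = (\<Inter>b. {x. x \<in> {x. f x b} \<longleftrightarrow> x \<in> V b} \<inter> {x. x \<in> - {x. f x b} \<longleftrightarrow> x \<in> W b})"
  have "comeager C"
    unfolding C_def using V(2) W(2) by (intro comeager_INT comeager_Int)
  moreover have "\<exists>a. \<forall>y\<in>C. agree a x y \<longrightarrow> agree b (f x) (f y)" if x: "x \<in> C" for x b
  proof -
    have "\<exists>a. \<forall>y\<in>C. agree a x y \<longrightarrow> f x c = f y c" for c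
    proof (cases "f x c")
      case True
      then have "x \<in> V c"
        using x by (auto simp: C_def)
      then obtain a where "\<forall>y. agree a x y \<longrightarrow> y \<in> V c"
        using V(1)[of c] by (auto simp: openin_cantor_iff)
      then show ?thesis
        using True by (intro exI[of _ a]) (auto simp: C_def)
    next
      case False
      then have "x \<in> W c"
        using x by (auto simp: C_def)
      then obtain a where "\<forall>y. agree a x y \<longrightarrow> y \<in> W c"
        using W(1)[of c] by (auto simp: openin_cantor_iff)
      then show ?thesis
        using False by (intro exI[of _ a]) (auto simp: C_def)
    qed
    then obtain m where m: "\<And>c y. y \<in> C \<Longrightarrow> agree (m c) x y \<Longrightarrow> f x c = f y c"
      by metis
    obtain a where "\<forall>c<b. m c < a"
      using bounded_family by blast
    then have "agree b (f x) (f y)" if "y \<in> C" "agree a x y" for y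
      using m[OF that(1) agree_mono[OF that(2)]] by (auto simp: agree_def[of b] less_imp_le)
    then show ?thesis
      by blast
  qed
  ultimately show ?thesis
    by blast
qed

end

section \<open>The equivalence relations\<close>

definition diff :: "('k \<Rightarrow> bool) \<Rightarrow> ('k \<Rightarrow> bool) \<Rightarrow> 'k set" where
  "diff x y = {a. x a \<noteq> y a}"

text \<open>
  The germ of \<open>D\<close> at \<open>a\<close> relative to \<open>P\<close> is full or empty. These germs form a group under symmetric
  difference, so that pairs of points with such difference sets form an equivalence relation.
\<close>

definition good :: "'k::wellorder \<Rightarrow> 'k set \<Rightarrow> 'k set \<Rightarrow> bool" where
  "good a P D \<longleftrightarrow> (\<exists>b<a. P \<inter> {b<..<a} \<subseteq> D \<or> P \<inter> {b<..<a} \<inter> D = {})"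

lemma diff_refl [simp]: "diff x x = {}"
  by (simp add: diff_def)

lemma diff_sym: "diff x y = diff y x"
  by (auto simp: diff_def)

lemma goodI_bdd:
  assumes "b < a" "\<And>d. d \<in> P \<Longrightarrow> d \<in> D \<Longrightarrow> d < a \<Longrightarrow> d \<le> b"
  shows "good a P D"
proof -
  have "P \<inter> {b<..<a} \<inter> D = {}"
    using assms(2) by fastforce
  then show ?thesis
    unfolding good_def using assms(1) by blast
qed

lemma good_cong:
  assumes "good a P D" "\<And>d. d < a \<Longrightarrow> d \<in> P \<Longrightarrow> d \<in> D \<longleftrightarrow> d \<in> D'"
  shows "good a P D'"
proof -
  obtain b where b: "b < a" "P \<inter> {b<..<a} \<subseteq> D \<or> P \<inter> {b<..<a} \<inter> D = {}"
    using assms(1) unfolding good_def by blast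
  have "P \<inter> {b<..<a} \<subseteq> D' \<or> P \<inter> {b<..<a} \<inter> D' = {}"
    using b(2) assms(2) by auto
  then show ?thesis
    unfolding good_def using b(1) by blast
qed

lemma good_trans:
  assumes "good a P (diff x y)" "good a P (diff y z)"
  shows "good a P (diff x z)"
proof -
  obtain b where b: "b < a" "P \<inter> {b<..<a} \<subseteq> diff x y \<or> P \<inter> {b<..<a} \<inter> diff x y = {}"
    using assms(1) unfolding good_def by blast
  obtain c where c: "c < a" "P \<inter> {c<..<a} \<subseteq> diff y z \<or> P \<inter> {c<..<a} \<inter> diff y z = {}"
    using assms(2) unfolding good_def by blast
  let ?I = "P \<inter> {max b c<..<a}"
  have 1: "?I \<subseteq> diff x y \<or> ?I \<inter> diff x y = {}"
    using b(2) by auto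
  have 2: "?I \<subseteq> diff y z \<or> ?I \<inter> diff y z = {}"
    using c(2) by auto
  have "?I \<subseteq> diff x z \<or> ?I \<inter> diff x z = {}"
    using 1 2 unfolding diff_def by blast
  then show ?thesis
    unfolding good_def using b(1) c(1) by (intro exI[of _ "max b c"]) auto
qed

lemma good_agree:
  assumes "agree a x y"
  shows "good a P (diff z x) \<longleftrightarrow> good a P (diff z y)"
proof -
  have "d \<in> diff z x \<longleftrightarrow> d \<in> diff z y" if "d < a" for d
    using agreeD[OF assms that] by (simp add: diff_def)
  then show ?thesis
    using good_cong[of a P "diff z x" "diff z y"] good_cong[of a P "diff z y" "diff z x"] by blast
qed

locale split_pair = regular_pair l dec
  for l :: "'k::wellorder" and dec +
  fixes A :: "'k set"
  assumes A_lim: "A \<subseteq> lim_points"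
    and A_stat: "l_stationary l A"
    and B_stat: "l_stationary l (lim_points - A)"

context regular_pair
begin

lemma E0_diff: "(x, y) \<in> E0 \<longleftrightarrow> bdd_above (diff x y)"
  by (simp add: E0_def diff_def)

abbreviation cell :: "nat \<Rightarrow> 'k set" where
  "cell j \<equiv> {a. tag a = j}"

text \<open>A canonical representative of the class of \<open>x\<close> under agreement up to a flip of the cell near \<open>a\<close>.\<close>

definition rep :: "'k \<Rightarrow> nat \<Rightarrow> ('k \<Rightarrow> bool) \<Rightarrow> ('k \<Rightarrow> bool)" where
  "rep a j x = (SOME y. good a (cell j) (diff y x))"

lemma good_empty: "a \<in> lim_points \<Longrightarrow> good a P {}"
  using lim_points_less by (auto simp: good_def)

lemma rep_eq_iff:
  assumes "a \<in> lim_points"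
  shows "rep a j x = rep a j y \<longleftrightarrow> good a (cell j) (diff x y)"
proof
  assume "rep a j x = rep a j y"
  moreover have "good a (cell j) (diff (rep a j z) z)" for z
    unfolding rep_def
    by (rule someI[of "\<lambda>y. good a (cell j) (diff y z)" z]) (simp add: good_empty[OF assms])
  ultimately show "good a (cell j) (diff x y)"
    using good_trans diff_sym by metis
next
  assume *: "good a (cell j) (diff x y)"
  then have **: "good a (cell j) (diff y x)"
    by (simp add: diff_sym)
  have "(\<lambda>z. good a (cell j) (diff z x)) = (\<lambda>z. good a (cell j) (diff z y))"
    by (rule ext, rule iffI) (erule good_trans[OF _ *], erule good_trans[OF _ **])
  then show "rep a j x = rep a j y"
    unfolding rep_def by simp
qed

lemma rep_agree: "agree a x y \<Longrightarrow> rep a j x = rep a j y"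
  unfolding rep_def by (simp add: good_agree)

text \<open>
  If \<open>D\<close> met and missed \<open>P\<close> unboundedly often, it would do so below some \<open>a \<in> S\<close>.
\<close>

lemma stationary_good:
  assumes S: "l_stationary l S" and good: "\<And>a. a \<in> S \<Longrightarrow> good a P D"
  shows "bdd_above (P \<inter> D) \<or> bdd_above (P - D)"
proof (rule ccontr)
  assume neg: "\<not> ?thesis"
  obtain l0 where l0: "l < l0"
    using ex_greater by blast
  let ?C = "\<lambda>x. if x = l then P \<inter> D else P - D"
  have "\<not> bdd_above (?C x)" for x
    using neg by simp
  then obtain a where a: "a \<in> S" "l0 < a" "\<And>x. x < a \<Longrightarrow> cofinal_in (?C x) a"
    using stationary_diagonal[OF S, of ?C] by metis
  have 1: "cofinal_in (P \<inter> D) a"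
    using a(3)[of l] l0 a(2) by simp
  have 2: "cofinal_in (P - D) a"
    using a(3)[of l0] l0 a(2) by (simp split: if_splits)
  obtain b where b: "b < a" "P \<inter> {b<..<a} \<subseteq> D \<or> P \<inter> {b<..<a} \<inter> D = {}"
    using good[OF a(1)] unfolding good_def by blast
  obtain c where "c \<in> P \<inter> D" "b < c" "c < a"
    using 1 b(1) unfolding cofinal_in_def by blast
  moreover obtain d where "d \<in> P - D" "b < d" "d < a"
    using 2 b(1) unfolding cofinal_in_def by blast
  ultimately show False
    using b(2) by auto
qed

text \<open>The coordinate in the equality part that switches on the equalities coding \<open>X\<close> in \<open>R X\<close>.\<close>

definition mark :: 'k where "mark = pos 2 l l"

end

context split_pair
begin

text \<open>
  The limit points that carry a condition for cell \<open>j\<close>. Both sets stay stationary for every \<open>X\<close>, and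
  their intersection is the set of limit points outside \<open>X\<close>.
\<close>

definition active :: "nat \<Rightarrow> 'k set \<Rightarrow> 'k set" where
  "active j X = lim_points - (if j = 0 then X \<inter> A else X - A)"

text \<open>
  The map \<open>F\<close> of the theorem. Cells 0 and 1 carry the conditions at limit points, all other cells
  equality. The clause for \<open>mark\<close> serves injectivity only; reductions into \<open>R X\<close> and the generic
  arguments take place where \<open>mark\<close> is off.
\<close>

definition R :: "'k set \<Rightarrow> ('k \<Rightarrow> bool) rel" where
  "R X = {(x, y) \<in> E0.
     (\<forall>a. 2 \<le> tag a \<longrightarrow> x a = y a) \<and>
     (x mark \<longrightarrow> (\<forall>a\<in>X. x (pos 0 a l) = y (pos 0 a l))) \<and>
     (\<forall>j<2. \<forall>a\<in>active j X. good a (cell j) (diff x y))}"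

text \<open>
  What \<open>R X\<close> demands beyond \<open>E0\<close> is that a sequence of bits be equal: representatives of the germs
  at the active points, and the coordinates with a demand of equality.
\<close>

definition invariant :: "'k set \<Rightarrow> ('k \<Rightarrow> bool) \<Rightarrow> ('k \<Rightarrow> bool)" where
  "invariant X x c = (
     if tag c < 2 then arg1 c \<in> active (tag c) X \<and> rep (arg1 c) (tag c) x (arg2 c)
     else if tag c = 2 then 2 \<le> tag (arg1 c) \<and> x (arg1 c)
     else tag c = 3 \<and> x mark \<and> arg1 c \<in> X \<and> x (pos 0 (arg1 c) l))"

lemma R_I:
  assumes "bdd_above (diff x y)" "\<And>a. 2 \<le> tag a \<Longrightarrow> x a = y a"
    and "\<And>a. x mark \<Longrightarrow> a \<in> X \<Longrightarrow> x (pos 0 a l) = y (pos 0 a l)"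
    and "\<And>j a. j < 2 \<Longrightarrow> a \<in> active j X \<Longrightarrow> good a (cell j) (diff x y)"
  shows "(x, y) \<in> R X"
  using assms unfolding R_def E0_diff by simp

lemma R_D:
  assumes "(x, y) \<in> R X"
  shows "bdd_above (diff x y)" "2 \<le> tag a \<Longrightarrow> x a = y a"
    and "x mark \<Longrightarrow> b \<in> X \<Longrightarrow> x (pos 0 b l) = y (pos 0 b l)"
    and "j < 2 \<Longrightarrow> c \<in> active j X \<Longrightarrow> good c (cell j) (diff x y)"
  using assms unfolding R_def E0_diff by simp_all

lemma active_lim: "a \<in> active j X \<Longrightarrow> a \<in> lim_points"
  by (simp add: active_def)

lemma active_stationary: "l_stationary l (active j X)"
proof (cases "j = 0")
  case True
  show ?thesis
    by (rule stationary_mono[OF B_stat]) (use True in \<open>auto simp: active_def\<close>)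
next
  case False
  show ?thesis
    by (rule stationary_mono[OF A_stat]) (use False A_lim in \<open>auto simp: active_def\<close>)
qed

lemma local_invariant: "local_map (invariant X)"
  unfolding local_map_def
proof
  fix c
  obtain a where a: "arg1 c < a" "mark < a" "pos 0 (arg1 c) l < a"
    using ex_greater[of "max (arg1 c) (max mark (pos 0 (arg1 c) l))"] by auto
  have "invariant X x c = invariant X y c" if "agree a x y" for x y
  proof -
    have "rep (arg1 c) j x = rep (arg1 c) j y" for j
      using agree_mono[OF that, of "arg1 c"] a(1) by (intro rep_agree) simp
    moreover have "x (arg1 c) = y (arg1 c)" "x mark = y mark" "x (pos 0 (arg1 c) l) = y (pos 0 (arg1 c) l)"
      using agreeD[OF that] a by auto
    ultimately show ?thesis
      by (simp add: invariant_def)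
  qed
  then show "\<exists>a. \<forall>x y. agree a x y \<longrightarrow> invariant X x c = invariant X y c"
    by blast
qed

lemma R_iff: "(x, y) \<in> R X \<longleftrightarrow> (x, y) \<in> E0 \<and> invariant X x = invariant X y"
proof
  assume "(x, y) \<in> R X"
  then have E: "(x, y) \<in> E0" and t: "\<And>a. 2 \<le> tag a \<Longrightarrow> x a = y a"
    and m: "\<And>a. x mark \<Longrightarrow> a \<in> X \<Longrightarrow> x (pos 0 a l) = y (pos 0 a l)"
    and g: "\<And>j a. j < 2 \<Longrightarrow> a \<in> active j X \<Longrightarrow> good a (cell j) (diff x y)"
    unfolding R_def by auto
  have mark: "x mark = y mark"
    using t[of mark] by (simp add: mark_def)
  have rep: "rep a j x = rep a j y" if "j < 2" "a \<in> active j X" for a j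
    using rep_eq_iff[OF active_lim[OF that(2)]] g[OF that] by simp
  have "invariant X x c = invariant X y c" for c
    unfolding invariant_def using mark m t rep[of "tag c" "arg1 c"] by auto
  then show "(x, y) \<in> E0 \<and> invariant X x = invariant X y"
    using E by blast
next
  assume *: "(x, y) \<in> E0 \<and> invariant X x = invariant X y"
  then have inv: "invariant X x c = invariant X y c" for c
    by simp
  have t: "x a = y a" if "2 \<le> tag a" for a
    using inv[of "pos 2 a l"] that by (simp add: invariant_def)
  moreover have "x (pos 0 a l) = y (pos 0 a l)" if "x mark" "a \<in> X" for a
    using inv[of "pos 3 a l"] that t[of mark] by (simp add: invariant_def mark_def)
  moreover have "good a (cell j) (diff x y)" if "j < 2" "a \<in> active j X" for a j
  proof -
    have "rep a j x c = rep a j y c" for c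
      using inv[of "pos j a c"] that by (simp add: invariant_def)
    then have "rep a j x = rep a j y"
      by blast
    then show ?thesis
      using rep_eq_iff[OF active_lim[OF that(2)]] by simp
  qed
  ultimately show "(x, y) \<in> R X"
    using * unfolding R_def by simp
qed

lemma R_borel_equiv: "R X \<in> borel_equivs"
proof -
  have eq: "R X = E0 \<inter> {(x, y). invariant X x = invariant X y}"
    using R_iff by auto
  have "equiv UNIV (R X)"
  proof (rule equivI)
    show "refl_on UNIV (R X)"
      using equiv_E0 by (simp add: equiv_def refl_on_def R_iff)
    show "sym (R X)"
      using equiv_E0 unfolding equiv_def sym_def R_iff by metis
    show "trans (R X)"
      using equiv_E0 unfolding equiv_def trans_def R_iff by metis
  qed simp
  moreover have "(\<Inter>i. if i = l then E0 else {(x, y). invariant X x = invariant X y})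
      \<in> borel_of_length (kappa :: 'k rel) (prod_topology cantor_top cantor_top)"
    by (rule borel_INT) (simp add: E0_borel kernel_borel[OF local_invariant])
  moreover have "(\<Inter>i. if i = l then E0 else {(x, y). invariant X x = invariant X y}) = R X"
  proof -
    obtain i where i: "l < i"
      using ex_greater by blast
    show ?thesis
    proof
      have "(\<Inter>i. if i = l then E0 else {(x, y). invariant X x = invariant X y})
          \<subseteq> (if l = l then E0 else {(x, y). invariant X x = invariant X y}) \<inter>
            (if i = l then E0 else {(x, y). invariant X x = invariant X y})"
        by blast
      then show "(\<Inter>i. if i = l then E0 else {(x, y). invariant X x = invariant X y}) \<subseteq> R X"
        unfolding eq using i by (simp only: refl if_True less_imp_neq[THEN not_sym] if_False)
    qed (auto simp: eq)
  qed
  ultimately show ?thesis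
    unfolding borel_equivs_def by simp
qed

text \<open>
  With \<open>mark\<close> switched on, a difference in the single coordinate that codes \<open>a\<close> is allowed if and only
  if \<open>a\<close> is not in \<open>X\<close>.
\<close>

lemma R_inj_aux:
  assumes "R X = R Y"
  shows "X \<subseteq> Y"
proof
  fix a assume a: "a \<in> X"
  show "a \<in> Y"
  proof (rule ccontr)
    assume "a \<notin> Y"
    let ?x = "\<lambda>b. b = mark" and ?w = "pos 0 a l"
    let ?y = "flip {?w} ?x"
    have D: "diff ?x ?y = {?w}"
      by (auto simp: diff_def flip_def)
    have t: "?x b = ?y b" if "b \<noteq> ?w" for b
      using that by (simp add: flip_def)
    have "(?x, ?y) \<in> R Y"
    proof (rule R_I)
      show "?x b = ?y b" if "2 \<le> tag b" for b
        using that by (intro t) auto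
      show "?x (pos 0 b l) = ?y (pos 0 b l)" if "b \<in> Y" for b
      proof (rule t)
        show "pos 0 b l \<noteq> ?w"
          using that \<open>a \<notin> Y\<close> pos_simps(2)[of 0 b l] pos_simps(2)[of 0 a l] by metis
      qed
      show "good b (cell j) (diff ?x ?y)" if hb: "b \<in> active j Y" for j b
      proof -
        obtain c where c: "c < b"
          using active_lim[OF hb] lim_points_less by blast
        show ?thesis
          unfolding D by (rule goodI_bdd[of "if ?w < b then ?w else c"]) (use c in auto)
      qed
    next
      show "bdd_above (diff ?x ?y)"
        unfolding D by (rule bdd_aboveI[of _ ?w]) simp
    qed
    then have "(?x, ?y) \<in> R X"
      using assms by simp
    then have "?x ?w = ?y ?w"
      using R_D(3)[of ?x ?y X a] a by simp
    then show False
      by (simp add: flip_def)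
  qed
qed

lemma inj_R: "inj R"
  using R_inj_aux by (intro injI subset_antisym) blast+

section \<open>Reductions\<close>

lemma Id_le_R: "Id \<le>\<^sub>B R X"
  unfolding borel_reducible_def
proof (intro exI conjI allI)
  let ?f = "\<lambda>(x :: 'k \<Rightarrow> bool) c. tag c = 3 \<and> x (arg1 c)"
  have "\<exists>a. \<forall>x y. agree a x y \<longrightarrow> ?f x c = ?f y c" for c
    using ex_greater[of "arg1 c"] by (auto simp: agree_def)
  then show "borel_function ?f"
    by (intro local_map_borel) (simp add: local_map_def)
  show "(x, y) \<in> Id \<longleftrightarrow> (?f x, ?f y) \<in> R X" for x y
  proof
    assume "(x, y) \<in> Id"
    then show "(?f x, ?f y) \<in> R X"
      using equiv_E0 by (auto simp: R_iff equiv_def refl_on_def)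
  next
    assume *: "(?f x, ?f y) \<in> R X"
    have "x a = y a" for a
      using R_D(2)[OF *, of "pos 3 a l"] by simp
    then show "(x, y) \<in> Id"
      by auto
  qed
qed

text \<open>
  Every bit of the invariant is repeated unboundedly often, so that two points with different
  invariants have images that are not \<open>E0\<close>-equivalent.
\<close>

lemma R_le_E0: "R X \<le>\<^sub>B E0"
  unfolding borel_reducible_def
proof (intro exI conjI allI)
  let ?f = "\<lambda>(x :: 'k \<Rightarrow> bool) c.
    if tag c = 0 then arg2 c = l \<and> x (arg1 c) else tag c = 1 \<and> invariant X x (arg2 c)"
  have "\<exists>a. \<forall>x y. agree a x y \<longrightarrow> ?f x c = ?f y c" for c
  proof -
    obtain a where a: "\<And>x y. agree a x y \<Longrightarrow> invariant X x (arg2 c) = invariant X y (arg2 c)"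
      using local_invariant[of X] unfolding local_map_def by blast
    obtain b where b: "max a (arg1 c) < b"
      using ex_greater by blast
    have "?f x c = ?f y c" if "agree b x y" for x y
      using a[OF agree_mono[OF that]] agreeD[OF that, of "arg1 c"] b by (simp add: less_imp_le)
    then show ?thesis
      by blast
  qed
  then show "borel_function ?f"
    by (intro local_map_borel) (simp add: local_map_def)
  show "(x, y) \<in> R X \<longleftrightarrow> (?f x, ?f y) \<in> E0" for x y
  proof
    assume xy: "(x, y) \<in> R X"
    have "diff (?f x) (?f y) \<subseteq> (\<lambda>b. pos 0 b l) ` diff x y"
    proof
      fix c assume "c \<in> diff (?f x) (?f y)"
      then have c: "tag c = 0" "arg2 c = l" "arg1 c \<in> diff x y"
        using xy by (auto simp: diff_def R_iff split: if_splits)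
      then have "c = pos 0 (arg1 c) l"
        using pos_cover[of c] by simp
      then show "c \<in> (\<lambda>b. pos 0 b l) ` diff x y"
        using c(3) by blast
    qed
    moreover have "bdd_above ((\<lambda>b. pos 0 b l) ` diff x y)"
      by (rule bdd_image) (rule R_D(1)[OF xy])
    ultimately show "(?f x, ?f y) \<in> E0"
      unfolding E0_diff by (rule bdd_above_mono[rotated])
  next
    assume "(?f x, ?f y) \<in> E0"
    then have bdd: "bdd_above (diff (?f x) (?f y))"
      by (simp only: E0_diff)
    have "(\<lambda>b. pos 0 b l) ` diff x y \<subseteq> diff (?f x) (?f y)"
      by (auto simp: diff_def)
    then have "bdd_above ((\<lambda>b. pos 0 b l) ` diff x y)"
      by (rule bdd_above_mono[OF bdd])
    then have "bdd_above (diff x y)"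
      using unbounded_pos2[of 0 l "diff x y"] by simp
    moreover have "invariant X x b = invariant X y b" for b
    proof (rule ccontr)
      assume "invariant X x b \<noteq> invariant X y b"
      then have "(\<lambda>a. pos 1 a b) ` UNIV \<subseteq> diff (?f x) (?f y)"
        by (auto simp: diff_def)
      then have "bdd_above ((\<lambda>a. pos 1 a b) ` UNIV)"
        by (rule bdd_above_mono[OF bdd])
      then show False
        using unbounded_pos2[of 1 b UNIV] unbounded_UNIV by simp
    qed
    ultimately show "(x, y) \<in> R X"
      by (simp add: R_iff E0_diff fun_eq_iff)
  qed
qed

text \<open>
  Let the cub set \<open>C\<close> avoid \<open>X - Y\<close>. The reduction copies the invariant, and in each of the first two
  cells it makes the image constant between successive points of \<open>C\<close>. Near a limit point that
  is not a limit of \<open>C\<close> the images thus agree or disagree throughout the cell, and the other limit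
  points belong to \<open>C\<close>, where every condition of \<open>R Y\<close> is one of \<open>R X\<close>. Conversely, the invariant determines
  the difference set up to a bounded set and a flip, as the conditions of \<open>R X\<close> range over stationary
  sets; so the sparse sample taken at the points of \<open>C\<close> suffices to detect a flip.
\<close>

lemma R_le_R:
  assumes C: "l_cub l C" "(X - Y) \<inter> C = {}"
  shows "R X \<le>\<^sub>B R Y"
  unfolding borel_reducible_def
proof (intro exI conjI allI)
  define jump where "jump a = (LEAST c. c \<in> C \<and> a \<le> c)" for a
  define next_in where "next_in j a = (LEAST b. tag b = j \<and> jump a \<le> b)" for j a
  let ?f = "\<lambda>(x :: 'k \<Rightarrow> bool) c. 
    if tag c < 2 then x (next_in (tag c) c) else tag c = 3 \<and> invariant X x (arg1 c)"
  have jump: "jump a \<in> C \<and> a \<le> jump a" for a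
    unfolding jump_def
  proof (rule LeastI_ex)
    show "\<exists>c. c \<in> C \<and> a \<le> c"
      using C(1) less_imp_le unfolding l_cub_def not_bdd_iff by blast
  qed
  have next_in: "tag (next_in j a) = j \<and> jump a \<le> next_in j a" for j a
    unfolding next_in_def
  proof (rule LeastI_ex)
    show "\<exists>b. tag b = j \<and> jump a \<le> b"
      using unbounded_tag[of j] less_imp_le unfolding not_bdd_iff by blast
  qed
  have next_ge: "a \<le> next_in j a" for a j
    using jump[of a] next_in[of j a] by (meson order_trans)
  have "\<exists>a. \<forall>x y. agree a x y \<longrightarrow> ?f x c = ?f y c" for c
  proof -
    obtain a where a: "\<And>x y. agree a x y \<Longrightarrow> invariant X x (arg1 c) = invariant X y (arg1 c)"
      using local_invariant[of X] unfolding local_map_def by blast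
    obtain b where b: "max a (next_in (tag c) c) < b"
      using ex_greater by blast
    have "?f x c = ?f y c" if "agree b x y" for x y
      using a[OF agree_mono[OF that]] agreeD[OF that, of "next_in (tag c) c"] b by (simp add: less_imp_le)
    then show ?thesis
      by blast
  qed
  then show "borel_function ?f"
    by (intro local_map_borel) (simp add: local_map_def)
  have mark: "\<not> ?f x mark" for x
    by (simp add: mark_def)
  show "(x, y) \<in> R X \<longleftrightarrow> (?f x, ?f y) \<in> R Y" for x y
  proof
    assume xy: "(x, y) \<in> R X"
    have D: "c \<in> diff (?f x) (?f y) \<longleftrightarrow> tag c < 2 \<and> next_in (tag c) c \<in> diff x y" for c
      using xy by (simp add: R_iff diff_def)
    show "(?f x, ?f y) \<in> R Y"
    proof (rule R_I)
      obtain b where "\<And>d. d \<in> diff x y \<Longrightarrow> d \<le> b"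
        using R_D(1)[OF xy] by (auto simp: bdd_above_def)
      then have "c \<le> b" if "c \<in> diff (?f x) (?f y)" for c
        using that next_ge[of c "tag c"] unfolding D by (meson order_trans)
      then show "bdd_above (diff (?f x) (?f y))"
        unfolding bdd_above_def by blast
      show "?f x a = ?f y a" if "2 \<le> tag a" for a
        using xy that by (simp add: R_iff)
      show "?f x (pos 0 a l) = ?f y (pos 0 a l)" if "?f x mark" for a
        using that mark by blast
      fix j a assume j: "j < (2 :: nat)" and a: "a \<in> active j Y"
      show "good a (cell j) (diff (?f x) (?f y))"
      proof (cases "cofinal_in C a")
        case True
        have "a \<in> C"
          using l_cub_cofinal[OF C(1) active_lim[OF a] True] .
        then have "a \<in> active j X"
          using a C(2) unfolding active_def by (auto split: if_splits)
        then have "good a (cell j) (diff x y)"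
          using R_D(4)[OF xy j] by blast
        then obtain b where b: "b < a"
            "cell j \<inter> {b<..<a} \<subseteq> diff x y \<or> cell j \<inter> {b<..<a} \<inter> diff x y = {}"
          unfolding good_def by blast
        show ?thesis
        proof (cases "cofinal_in (cell j) a")
          case True
          have *: "next_in j c \<in> cell j \<inter> {b<..<a}" if c: "b < c" "c < a" for c
          proof -
            obtain c' where c': "c' \<in> C" "c < c'" "c' < a"
              using \<open>cofinal_in C a\<close> c(2) unfolding cofinal_in_def by blast
            have "jump c \<le> c'"
              unfolding jump_def by (rule Least_le) (use c' in auto)
            then have "jump c < a"
              using c'(3) by simp
            then obtain d where d: "tag d = j" "jump c < d" "d < a"
              using True unfolding cofinal_in_def by blast
            have "next_in j c \<le> d"
              unfolding next_in_def by (rule Least_le) (use d in auto)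
            then show ?thesis
              using d(3) next_ge[of c j] c(1) next_in[of j c] by (simp add: order.strict_trans1 order.strict_trans2)
          qed
          have "cell j \<inter> {b<..<a} \<subseteq> diff (?f x) (?f y) \<or> cell j \<inter> {b<..<a} \<inter> diff (?f x) (?f y) = {}"
            using b(2)
          proof
            assume "cell j \<inter> {b<..<a} \<subseteq> diff x y"
            then have "c \<in> diff (?f x) (?f y)" if "c \<in> cell j \<inter> {b<..<a}" for c
              unfolding D using * that j by auto
            then show ?thesis
              by blast
          next
            assume "cell j \<inter> {b<..<a} \<inter> diff x y = {}"
            then have "c \<notin> diff (?f x) (?f y)" if "c \<in> cell j \<inter> {b<..<a}" for c
              unfolding D using *[of c] that by auto
            then show ?thesis
              by blast
          qed
          then show ?thesis
            unfolding good_def using b(1) by blast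
        next
          case False
          then obtain b' where "b' < a" "\<forall>c\<in>cell j. b' < c \<longrightarrow> \<not> c < a"
            using not_cofinal_inD by blast
          then have "b' < a" "cell j \<inter> {b'<..<a} \<subseteq> diff (?f x) (?f y)"
            by auto
          then show ?thesis
            unfolding good_def by blast
        qed
      next
        case False
        then obtain b where b: "b < a" "\<forall>c\<in>C. b < c \<longrightarrow> \<not> c < a"
          using not_cofinal_inD by blast
        have "jump c = jump a" if "b < c" "c < a" for c
        proof -
          have "d \<in> C \<and> c \<le> d \<longleftrightarrow> d \<in> C \<and> a \<le> d" for d
            using that b(2) by (meson leI less_imp_le order.strict_trans1 order.strict_trans2)
          then show ?thesis
            unfolding jump_def by simp
        qed
        then have "next_in j c = next_in j a" if "b < c" "c < a" for c
          using that unfolding next_in_def by simp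
        then have "c \<in> diff (?f x) (?f y) \<longleftrightarrow> next_in j a \<in> diff x y" if "c \<in> cell j \<inter> {b<..<a}" for c
          unfolding D using that j by auto
        then have "cell j \<inter> {b<..<a} \<subseteq> diff (?f x) (?f y) \<or> cell j \<inter> {b<..<a} \<inter> diff (?f x) (?f y) = {}"
          by blast
        then show ?thesis
          unfolding good_def using b(1) by blast
      qed
    qed
  next
    assume xy: "(?f x, ?f y) \<in> R Y"
    have "invariant X x c = invariant X y c" for c
      using R_D(2)[OF xy, of "pos 3 c l"] by simp
    then have inv: "invariant X x = invariant X y"
      by blast
    have t: "x a = y a" if "2 \<le> tag a" for a
      using fun_cong[OF inv, of "pos 2 a l"] that by (simp add: invariant_def)
    have bdd: "bdd_above (cell j \<inter> diff x y)" if j: "j < 2" for j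
    proof -
      have "good a (cell j) (diff x y)" if a: "a \<in> active j X" for a
      proof -
        have "rep a j x c = rep a j y c" for c
          using fun_cong[OF inv, of "pos j a c"] j a by (simp add: invariant_def)
        then have "rep a j x = rep a j y"
          by blast
        then show ?thesis
          using rep_eq_iff[OF active_lim[OF a]] by simp
      qed
      then have "bdd_above (cell j \<inter> diff x y) \<or> bdd_above (cell j - diff x y)"
        by (rule stationary_good[OF active_stationary])
      moreover have "\<not> bdd_above (cell j - diff x y)"
      proof
        assume "bdd_above (cell j - diff x y)"
        then obtain b where b: "\<And>c. c \<in> cell j - diff x y \<Longrightarrow> c \<le> b"
          by (auto simp: bdd_above_def)
        obtain b' where b': "\<And>c. c \<in> diff (?f x) (?f y) \<Longrightarrow> c \<le> b'"
          using R_D(1)[OF xy] unfolding bdd_above_def by blast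
        obtain c where c: "tag c = j" "max b b' < c"
          using unbounded_tag[of j] unfolding not_bdd_iff by blast
        have "next_in j c \<in> diff x y"
        proof (rule ccontr)
          assume "next_in j c \<notin> diff x y"
          then have "next_in j c \<le> b"
            using b[of "next_in j c"] next_in[of j c] by simp
          then show False
            using next_ge[of c j] c(2) by (meson leD max_less_iff_conj order_trans)
        qed
        then have "c \<in> diff (?f x) (?f y)"
          using c(1) j by (simp add: diff_def)
        then show False
          using b'[of c] c(2) by (meson leD max_less_iff_conj)
      qed
      ultimately show ?thesis
        by simp
    qed
    have "diff x y \<subseteq> (cell 0 \<inter> diff x y) \<union> (cell 1 \<inter> diff x y)"
    proof
      fix a assume a: "a \<in> diff x y"
      then have "\<not> 2 \<le> tag a"
        using t by (auto simp: diff_def)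
      then have "tag a = 0 \<or> tag a = 1"
        by auto
      then show "a \<in> (cell 0 \<inter> diff x y) \<union> (cell 1 \<inter> diff x y)"
        using a by auto
    qed
    moreover have "bdd_above ((cell 0 \<inter> diff x y) \<union> (cell 1 \<inter> diff x y))"
    proof -
      obtain b b' where "\<And>c. c \<in> cell 0 \<inter> diff x y \<Longrightarrow> c \<le> b" "\<And>c. c \<in> cell 1 \<inter> diff x y \<Longrightarrow> c \<le> b'"
        using bdd[of 0] bdd[of 1] unfolding bdd_above_def by auto
      then show ?thesis
        by (intro bdd_aboveI[of _ "max b b'"]) (auto simp: le_max_iff_disj)
    qed
    ultimately have "bdd_above (diff x y)"
      by (rule bdd_above_mono[rotated])
    then show "(x, y) \<in> R X"
      unfolding R_iff E0_diff using inv by simp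
  qed
qed

end

section \<open>Irreducibility\<close>

context split_pair
begin

text \<open>
  The following context fixes a reduction \<open>f\<close> of \<open>E\<close> to \<open>R Y\<close> that is continuous on the comeager set
  \<open>C\<close>. Of the source \<open>E\<close> it only matters that flips of bounded subsets of one cell that are good at
  \<open>S\<close> lead to equivalent points, and that flips of end segments of the cell do not. This covers both
  \<open>E0\<close>, with \<open>S\<close> empty, and \<open>R X\<close>, with \<open>S\<close> the active points of the cell.
\<close>

lemma R_refl: "(x, x) \<in> R X"
  by (simp add: R_iff E0_iff)

context
  fixes f :: "('k \<Rightarrow> bool) \<Rightarrow> ('k \<Rightarrow> bool)" and E :: "('k \<Rightarrow> bool) rel" and j :: nat and S Y :: "'k set"
    and C :: "('k \<Rightarrow> bool) set"
  assumes red: "\<And>x y. (x, y) \<in> E \<longleftrightarrow> (f x, f y) \<in> R Y"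
    and rel: "\<And>x D. \<not> x mark \<Longrightarrow> D \<subseteq> cell j \<Longrightarrow> bdd_above D \<Longrightarrow>
      (\<And>a. a \<in> S \<Longrightarrow> good a (cell j) D) \<Longrightarrow> (x, flip D x) \<in> E"
    and unrel: "\<And>x b. (x, flip (cell j \<inter> {b..}) x) \<notin> E"
    and S: "S \<subseteq> lim_points"
    and C: "comeager C"
    and cont: "\<And>x b. x \<in> C \<Longrightarrow> \<exists>a. \<forall>y\<in>C. agree a x y \<longrightarrow> agree b (f x) (f y)"
begin

text \<open>
  A condition is a pair of a length and a function whose two components are initial segments of the
  two points under construction.
\<close>

definition conflict :: "'k \<times> ('k \<Rightarrow> bool \<times> bool) \<Rightarrow> 'k set" where
  "conflict r = {b. b < fst r \<and> fst (snd r b) \<noteq> snd (snd r b)}"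

definition ok :: "'k \<times> ('k \<Rightarrow> bool \<times> bool) \<Rightarrow> bool" where
  "ok r \<longleftrightarrow> mark < fst r \<and> \<not> fst (snd r mark) \<and> conflict r \<subseteq> cell j \<and>
     (\<forall>c\<in>S. good c (cell j) (conflict r))"

definition extends :: "'k \<times> ('k \<Rightarrow> bool \<times> bool) \<Rightarrow> 'k \<times> ('k \<Rightarrow> bool \<times> bool) \<Rightarrow> bool" where
  "extends r s \<longleftrightarrow> fst s \<le> fst r \<and> agree (fst s) (snd s) (snd r)"

definition inside :: "'k \<times> ('k \<Rightarrow> bool \<times> bool) \<Rightarrow> ('k \<Rightarrow> bool) \<Rightarrow> ('k \<Rightarrow> bool) \<Rightarrow> bool" where
  "inside r x y \<longleftrightarrow> agree (fst r) (snd r) (\<lambda>b. (x b, y b))"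

definition forces :: "'k \<times> ('k \<Rightarrow> bool \<times> bool) \<Rightarrow> (bool \<Rightarrow> bool \<Rightarrow> bool) \<Rightarrow> 'k \<Rightarrow> bool" where
  "forces r Q b \<longleftrightarrow> (\<forall>x\<in>C. \<forall>y\<in>C. inside r x y \<longrightarrow> Q (f x b) (f y b))"

lemma extends_refl: "extends r r"
  by (simp add: extends_def)

lemma extends_trans: "extends r s \<Longrightarrow> extends s t \<Longrightarrow> extends r t"
  unfolding extends_def by (meson agree_mono agree_trans order_trans)

lemma extends_inside: "extends r s \<Longrightarrow> inside r x y \<Longrightarrow> inside s x y"
  unfolding extends_def inside_def by (meson agree_mono agree_trans)

lemma forces_mono: "forces s Q b \<Longrightarrow> extends r s \<Longrightarrow> forces r Q b"
  unfolding forces_def using extends_inside by blast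

lemma conflict_bdd: "bdd_above (conflict r)"
  by (rule bdd_aboveI[of _ "fst r"]) (simp add: conflict_def less_imp_le)

text \<open>Two generic points that are equal beyond the length of the condition are equivalent.\<close>

lemma ok_pair:
  assumes "ok r"
  shows "\<exists>x\<in>C. flip (conflict r) x \<in> C \<and> inside r x (flip (conflict r) x) \<and>
    (f x, f (flip (conflict r) x)) \<in> R Y"
proof -
  obtain x where x: "x \<in> C" "flip (conflict r) x \<in> C" "agree (fst r) (\<lambda>b. fst (snd r b)) x"
    using generic_point[OF C, of "conflict r" "{}" "fst r" "\<lambda>b. fst (snd r b)"] by blast
  have "inside r x (flip (conflict r) x)"
    unfolding inside_def agree_def
  proof (intro allI impI)
    fix b assume b: "b < fst r"
    then have "x b = fst (snd r b)"
      using agreeD[OF x(3)] by simp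
    moreover have "flip (conflict r) x b = snd (snd r b)"
      using b calculation unfolding flip_def conflict_def by auto
    ultimately show "snd r b = (x b, flip (conflict r) x b)"
      by (simp add: prod_eq_iff)
  qed
  moreover have "\<not> x mark"
    using assms agreeD[OF x(3), of mark] unfolding ok_def by simp
  then have "(x, flip (conflict r) x) \<in> E"
    using assms conflict_bdd unfolding ok_def by (intro rel) auto
  ultimately show ?thesis
    using x red by blast
qed

text \<open>By continuity, values of \<open>f\<close> are decided by initial segments.\<close>

lemma decide:
  assumes "x \<in> C" "y \<in> C" "Q (f x c) (f y c)"
  shows "\<exists>g>a. forces (g, \<lambda>b. (x b, y b)) Q c"
proof -
  obtain b where b: "c < b"
    using ex_greater by blast
  obtain g1 where g1: "\<forall>x'\<in>C. agree g1 x x' \<longrightarrow> agree b (f x) (f x')"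
    using cont[OF assms(1)] by blast
  obtain g2 where g2: "\<forall>y'\<in>C. agree g2 y y' \<longrightarrow> agree b (f y) (f y')"
    using cont[OF assms(2)] by blast
  obtain g where g: "max a (max g1 g2) < g"
    using ex_greater by blast
  have "forces (g, \<lambda>b. (x b, y b)) Q c"
    unfolding forces_def
  proof (intro ballI impI)
    fix x' y' assume xy: "x' \<in> C" "y' \<in> C" and *: "inside (g, \<lambda>b. (x b, y b)) x' y'"
    have "agree g1 x x'" "agree g2 y y'"
      using * g unfolding inside_def agree_def by auto
    then have "agree b (f x) (f x')" "agree b (f y) (f y')"
      using g1 g2 xy by simp_all
    then have "f x c = f x' c" "f y c = f y' c"
      using agreeD b by blast+
    then show "Q (f x' c) (f y' c)"
      using assms(3) by simp
  qed
  then show ?thesis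
    using g by (intro exI[of _ g]) simp
qed

text \<open>
  Adding an interval that begins where \<open>D\<close> ends preserves goodness: up to \<open>s\<close> the new set is
  co-bounded, beyond \<open>s\<close> it is bounded. This is what co-bounded sets are admitted for.
\<close>

lemma good_add_interval:
  assumes c: "c \<in> lim_points" and D: "D \<subseteq> {..<a}" "good c (cell j) D"
    and D': "D' = D \<union> (cell j \<inter> {a..<s})"
  shows "good c (cell j) D'"
proof (cases "c \<le> a")
  case True
  show ?thesis
    by (rule good_cong[OF D(2)]) (use True D' in auto)
next
  case False
  show ?thesis
  proof (cases "c \<le> s")
    case True
    have "cell j \<inter> {a<..<c} \<subseteq> D'"
      unfolding D' using True by auto
    then show ?thesis
      unfolding good_def using False by (intro exI[of _ a]) simp
  next
    case sc: False
    show ?thesis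
    proof (rule goodI_bdd[of "max a s"])
      show "max a s < c"
        using False sc by (simp add: not_le)
      show "d \<le> max a s" if "d \<in> D'" for d
        using that D(1) unfolding D' by (auto simp: le_max_iff_disj less_imp_le)
    qed
  qed
qed

text \<open>
  The images of a pair can be made to differ at a new place while the pair remains good. Let \<open>z\<close> be
  generic above the first component \<open>p\<close>, and let \<open>t\<close> decide the image of \<open>z\<close> below \<open>a\<close>. For a generic
  \<open>w\<close> above \<open>z\<close> up to \<open>t\<close>, let \<open>v\<close> be its flip beyond \<open>t\<close>, and let \<open>y\<close> be the point above the second
  component that is the flip of \<open>w\<close> beyond \<open>a\<close>. The differences beyond \<open>a\<close> between \<open>w\<close> and \<open>y\<close>, as well
  as those between \<open>v\<close> and \<open>y\<close>, form an interval of the cell. If the image of \<open>y\<close> agreed beyond \<open>a\<close> with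
  those of both \<open>w\<close> and \<open>v\<close>, these two images would be equal, because they also agree below \<open>a\<close>; but
  \<open>w\<close> and \<open>v\<close> are not equivalent.
\<close>

lemma difference_step:
  assumes "ok r"
  shows "\<exists>r' b. ok r' \<and> extends r' r \<and> fst r \<le> b \<and> b < fst r' \<and> tag b < 2 \<and> forces r' (\<noteq>) b"
proof -
  define a where "a = fst r"
  define p where "p = (\<lambda>b. fst (snd r b))"
  define D where "D = conflict r"
  define B where "B = cell j \<inter> {a..}"
  have Da: "D \<subseteq> {..<a}" and Dj: "D \<subseteq> cell j"
    using assms by (auto simp: D_def conflict_def a_def ok_def)
  obtain z where z: "z \<in> C" "agree a p z"
    using baire_category[OF C] by blast
  obtain t0 where t0: "\<forall>w\<in>C. agree t0 z w \<longrightarrow> agree a (f z) (f w)"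
    using cont[OF z(1)] by blast
  define t where "t = max t0 a"
  obtain w where w: "w \<in> C" "flip (cell j \<inter> {t..}) w \<in> C" "flip (D \<union> B) w \<in> C" "agree t z w"
    using generic_point[OF C] by blast
  define v where "v = flip (cell j \<inter> {t..}) w"
  define y where "y = flip (D \<union> B) w"
  have wv: "agree t w v"
    by (auto simp: agree_def v_def flip_def)
  have pw: "agree a p w"
    by (rule agree_trans[OF z(2) agree_mono[OF w(4)]]) (simp add: t_def)
  have pv: "agree a p v"
    by (rule agree_trans[OF pw agree_mono[OF wv]]) (simp add: t_def)
  have fa: "agree a (f w) (f v)"
  proof -
    have "agree t0 z w" "agree t0 w v"
      using agree_mono[OF w(4), of t0] agree_mono[OF wv, of t0] by (simp_all add: t_def)
    moreover have "agree t0 z v"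
      using calculation by (rule agree_trans)
    ultimately have "agree a (f z) (f w)" "agree a (f z) (f v)"
      using t0 w(1,2) unfolding v_def by simp_all
    then show ?thesis
      by (rule agree_trans[OF agree_sym])
  qed
  have "\<exists>x\<in>{w, v}. \<exists>b\<ge>a. f x b \<noteq> f y b"
  proof (rule ccontr)
    assume neg: "\<not> ?thesis"
    have "f w b = f v b" for b
    proof (cases "a \<le> b")
      case True
      then have "f w b = f y b" "f v b = f y b"
        using neg by simp_all
      then show ?thesis
        by simp
    next
      case False
      then show ?thesis
        using agreeD[OF fa, of b] by (simp add: not_le)
    qed
    then have "f w = f v"
      by (rule HOL.ext)
    then have "(w, v) \<in> E"
      using red R_refl by simp
    then show False
      using unrel unfolding v_def by simp
  qed
  then obtain x b where x: "x \<in> {w, v}" and b: "a \<le> b" "f x b \<noteq> f y b"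
    by (elim bexE exE conjE)
  have dif: "\<exists>s. {c. c < g \<and> x c \<noteq> y c} = D \<union> (cell j \<inter> {a..<s})" if g: "a \<le> g" for g
  proof (cases "x = w")
    case True
    show ?thesis
      unfolding True using Da g by (intro exI[of _ g]) (auto simp: y_def B_def flip_def)
  next
    case False
    then have v: "x = v"
      using x by simp
    show ?thesis
      unfolding v using Da g
      by (intro exI[of _ "min t g"]) (auto simp: y_def v_def B_def flip_def t_def less_max_iff_disj)
  qed
  have xy: "x \<in> C" "y \<in> C"
    using x w unfolding v_def y_def by auto
  have px: "agree a p x"
    using x pw pv by auto
  obtain g where g: "b < g" and fo: "forces (g, \<lambda>b. (x b, y b)) (\<noteq>) b"
    using decide[of x y "(\<noteq>)" b b, OF xy b(2)] by (elim exE conjE)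
  let ?r = "(g, \<lambda>b. (x b, y b))"
  have ag: "a \<le> g"
    using b(1) g by simp
  obtain s where s: "conflict ?r = D \<union> (cell j \<inter> {a..<s})"
    using dif[OF ag] by (auto simp: conflict_def)
  have ok: "ok ?r"
    unfolding ok_def
  proof (intro conjI ballI)
    show "mark < fst ?r"
      using assms ag by (auto simp: ok_def a_def)
    show "\<not> fst (snd ?r mark)"
      using assms agreeD[OF px, of mark] by (simp add: ok_def a_def p_def)
    show "conflict ?r \<subseteq> cell j"
      using s Dj by auto
    show "good c (cell j) (conflict ?r)" if "c \<in> S" for c
      using assms that S by (intro good_add_interval[OF _ Da _ s]) (auto simp: ok_def D_def)
  qed
  have "extends ?r r"
    unfolding extends_def
  proof
    show "fst r \<le> fst ?r"
      using ag by (simp add: a_def)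
    show "agree (fst r) (snd r) (snd ?r)"
      unfolding agree_def
    proof (intro allI impI)
      fix c assume "c < fst r"
      then have c: "c < a"
        by (simp add: a_def)
      have 1: "x c = fst (snd r c)"
        using agreeD[OF px c] by (simp add: p_def)
      have "x c \<noteq> y c \<longleftrightarrow> c \<in> conflict ?r"
        using c ag by (auto simp: conflict_def)
      also have "\<dots> \<longleftrightarrow> c \<in> D"
        using s c by auto
      also have "\<dots> \<longleftrightarrow> fst (snd r c) \<noteq> snd (snd r c)"
        using c by (simp add: D_def conflict_def a_def)
      finally show "snd r c = snd ?r c"
        using 1 by (auto simp: prod_eq_iff)
    qed
  qed
  (* A pair meeting the new condition is equivalent, so its images agree in the equality cells. *)
  moreover have "tag b < 2"
  proof (rule ccontr)
    assume "\<not> tag b < 2"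
    obtain x' where x': "x' \<in> C" "flip (conflict ?r) x' \<in> C" "inside ?r x' (flip (conflict ?r) x')"
        "(f x', f (flip (conflict ?r) x')) \<in> R Y"
      using ok_pair[OF ok] by blast
    have "f x' b = f (flip (conflict ?r) x') b"
      using R_D(2)[OF x'(4)] \<open>\<not> tag b < 2\<close> by simp
    then show False
      using fo x' unfolding forces_def by blast
  qed
  ultimately show ?thesis
    using ok fo b g by (intro exI[of _ ?r] exI[of _ b]) (simp add: a_def)
qed

text \<open>
  A pair meeting the condition is equivalent, hence its images are \<open>E0\<close>-equivalent and agree from
  some point on.
\<close>

lemma agreement_step:
  assumes "ok r"
  shows "\<exists>r' e. ok r' \<and> extends r' r \<and> fst r \<le> e \<and> e < fst r' \<and> tag e = k \<and> forces r' (=) e"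
proof -
  define D where "D = conflict r"
  obtain x where x: "x \<in> C" "flip D x \<in> C" "inside r x (flip D x)" "(f x, f (flip D x)) \<in> R Y"
    using ok_pair[OF assms] unfolding D_def by blast
  obtain m where m: "\<And>c. c \<in> diff (f x) (f (flip D x)) \<Longrightarrow> c \<le> m"
    using R_D(1)[OF x(4)] unfolding bdd_above_def by blast
  obtain e where e: "tag e = k" "max m (fst r) < e"
    using unbounded_tag[of k] unfolding not_bdd_iff by blast
  have eq: "f x e = f (flip D x) e"
    using m[of e] e(2) by (auto simp: diff_def dest: leD)
  let ?p = "\<lambda>g. (g, \<lambda>b. (x b, flip D x b))"
  obtain g where g: "e < g" "forces (?p g) (=) e"
    using decide[of x "flip D x" "(=)" e e, OF x(1,2) eq] by (elim exE conjE)
  let ?r = "?p g"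
  have rg: "fst r \<le> g"
    using e(2) g(1) by (meson less_imp_le less_trans max_less_iff_conj)
  have con: "conflict ?r = D"
    using rg by (auto simp: conflict_def flip_def D_def)
  have ex: "extends ?r r"
    using x(3) rg unfolding extends_def inside_def by simp
  have "snd r mark = (x mark, flip D x mark)"
    using assms x(3) unfolding ok_def inside_def agree_def by simp
  then have "ok ?r"
    using assms rg con unfolding ok_def D_def by auto
  then show ?thesis
    using ex e g by (intro exI[of _ ?r] exI[of _ e]) (simp add: less_imp_le)
qed

text \<open>
  Below the length of one of the given conditions their union is good because that condition is, and
  above a bound for all the lengths it is good because it is bounded. So goodness at the limit can only
  fail at the supremum of the lengths.
\<close>

lemma ok_limit:
  fixes s :: "'i \<Rightarrow> 'k \<times> ('k \<Rightarrow> bool \<times> bool)"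
  assumes ok: "\<And>i. i \<in> I \<Longrightarrow> ok (s i)" and "I \<noteq> {}"
    and ext: "\<And>i i'. i \<in> I \<Longrightarrow> i' \<in> I \<Longrightarrow> extends (s i) (s i') \<or> extends (s i') (s i)"
    and a: "\<And>i. i \<in> I \<Longrightarrow> fst (s i) \<le> a"
    and lim: "\<And>c. c \<in> S \<Longrightarrow> (\<exists>i\<in>I. c \<le> fst (s i)) \<or> (\<exists>b<c. \<forall>i\<in>I. fst (s i) \<le> b)"
  shows "\<exists>z. ok (a, z) \<and> (\<forall>i\<in>I. extends (a, z) (s i))"
proof -
  have "agree (min (fst (s i)) (fst (s i'))) (snd (s i)) (snd (s i'))" if "i \<in> I" "i' \<in> I" for i i'
    using ext[OF that] unfolding extends_def by (auto simp: min_absorb1 min_absorb2 intro: agree_sym)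
  then obtain y where y: "\<And>i. i \<in> I \<Longrightarrow> agree (fst (s i)) (snd (s i)) y"
    using glue[of I s] by auto
  define z where "z c = (if \<exists>i\<in>I. c < fst (s i) then y c else (False, False))" for c
  have z: "agree (fst (s i)) (snd (s i)) z" if "i \<in> I" for i
    using y[OF that] that unfolding agree_def z_def by auto
  have con: "c \<in> conflict (a, z) \<longleftrightarrow> c \<in> conflict (s i)" if "i \<in> I" "c < fst (s i)" for c i
    using agreeD[OF z[OF that(1)] that(2)] a[OF that(1)] that(2) by (auto simp: conflict_def)
  have con_ex: "\<exists>i\<in>I. c < fst (s i) \<and> c \<in> conflict (s i)" if c: "c \<in> conflict (a, z)" for c
  proof -
    have "\<exists>i\<in>I. c < fst (s i)"
      using c unfolding conflict_def z_def by (auto split: if_splits)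
    then show ?thesis
      using con c by blast
  qed
  obtain i0 where i0: "i0 \<in> I"
    using assms(2) by blast
  have "ok (a, z)"
    unfolding ok_def
  proof (intro conjI ballI)
    show "mark < fst (a, z)"
      using ok[OF i0] a[OF i0] by (auto simp: ok_def intro: order.strict_trans2)
    show "\<not> fst (snd (a, z) mark)"
      using ok[OF i0] agreeD[OF z[OF i0], of mark] by (simp add: ok_def)
    show "conflict (a, z) \<subseteq> cell j"
      using con_ex ok unfolding ok_def by blast
    show "good c (cell j) (conflict (a, z))" if c: "c \<in> S" for c
      using lim[OF c]
    proof
      assume "\<exists>i\<in>I. c \<le> fst (s i)"
      then obtain i where i: "i \<in> I" "c \<le> fst (s i)"
        by blast
      have "good c (cell j) (conflict (s i))"
        using ok[OF i(1)] c by (simp add: ok_def)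
      then show ?thesis
        by (rule good_cong) (use con[OF i(1)] i(2) in auto)
    next
      assume "\<exists>b<c. \<forall>i\<in>I. fst (s i) \<le> b"
      then obtain b where b: "b < c" "\<forall>i\<in>I. fst (s i) \<le> b"
        by blast
      show ?thesis
      proof (rule goodI_bdd[OF b(1)])
        show "d \<le> b" if d: "d \<in> conflict (a, z)" for d
        proof -
          obtain i where "i \<in> I" "d < fst (s i)"
            using con_ex[OF d] by blast
          then show ?thesis
            using b(2) less_imp_le order_trans by blast
        qed
      qed
    qed
  qed
  then show ?thesis
    using z a unfolding extends_def by (intro exI[of _ z]) simp
qed

text \<open>
  Before stage \<open>\<lambda>\<close> of the game there are fewer than \<open>\<lambda>\<close> lengths, so they are not cofinal in a point
  of \<open>S\<close>, which has cofinality \<open>\<lambda>\<close>.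
\<close>

lemma ok_limit_stage:
  assumes i: "i < l" and r0: "ok r0" and s: "\<And>k. k < i \<Longrightarrow> ok (s k) \<and> extends (s k) r0"
    and ext: "\<And>k k'. k' < k \<Longrightarrow> k < i \<Longrightarrow> extends (s k) (s k')"
  shows "\<exists>r. ok r \<and> m \<le> fst r \<and> extends r r0 \<and> (\<forall>k<i. extends r (s k))"
proof -
  (* The index None stands for r0, which has to be extended even if i is the first stage. *)
  let ?I = "insert None (Some ` {..<i})" and ?s = "case_option r0 s"
  obtain b where b: "\<forall>k<i. fst (s k) < b"
    using bounded_family[of i "\<lambda>k. fst (s k)"] by blast
  define a where "a = max m (max b (fst r0))"
  have "\<exists>z. ok (a, z) \<and> (\<forall>i\<in>?I. extends (a, z) (?s i))"
  proof (rule ok_limit)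
    show "ok (?s k)" if "k \<in> ?I" for k
      using that r0 s by auto
    show "extends (?s k) (?s k') \<or> extends (?s k') (?s k)" if "k \<in> ?I" "k' \<in> ?I" for k k'
    proof (cases k; cases k')
      fix n n' assume "k = Some n" "k' = Some n'"
      then show ?thesis
        using that ext[of n n'] ext[of n' n] extends_refl by (cases n n' rule: linorder_cases) auto
    qed (use that s extends_refl in auto)
    show "fst (?s k) \<le> a" if "k \<in> ?I" for k
      using that b by (auto simp: a_def le_max_iff_disj less_imp_le)
    show "(\<exists>k\<in>?I. c \<le> fst (?s k)) \<or> (\<exists>b<c. \<forall>k\<in>?I. fst (?s k) \<le> b)" if c: "c \<in> S" for c
    proof (cases "\<exists>k\<in>?I. c \<le> fst (?s k)")
      case False
      then have less: "fst (?s k) < c" if "k \<in> ?I" for k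
        using that not_le by blast
      have "\<exists>b<c. \<forall>k<i. fst (s k) < b"
      proof (rule lim_points_bound[OF _ i])
        show "c \<in> lim_points"
          using c S by blast
        show "fst (s k) < c" if "k < i" for k
          using less[of "Some k"] that by simp
      qed
      then obtain b where "b < c" "\<forall>k<i. fst (s k) < b"
        by blast
      then have "max b (fst r0) < c" "\<forall>k\<in>?I. fst (?s k) \<le> max b (fst r0)"
        using less[of None] by (auto simp: le_max_iff_disj less_imp_le)
      then show ?thesis
        by blast
    qed simp
  qed simp
  then obtain z where z: "ok (a, z)" "\<And>k. k \<in> ?I \<Longrightarrow> extends (a, z) (?s k)"
    by blast
  have "extends (a, z) r0" "\<forall>k<i. extends (a, z) (s k)"
    using z(2)[of None] z(2)[of "Some _"] by auto
  moreover have "m \<le> fst (a, z)"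
    by (simp add: a_def)
  ultimately show ?thesis
    using z(1) by blast
qed

text \<open>
  Player II plays the lengths of a sequence of conditions along which the images are forced to differ
  and to agree again and again at positions with tag \<open>k\<close>. If the play ended at a limit point \<open>a\<close>
  outside \<open>S\<close> that is active for \<open>Y\<close> and the cell \<open>k\<close>, the limit of the conditions would again be
  good, so there would be an equivalent pair whose images violate the condition at \<open>a\<close>. Hence this is
  a winning strategy for keeping out of the set of these \<open>a\<close>, whose complement contains a cub set by the
  characterization.
\<close>

lemma game:
  assumes GC: "GC_characterization l" and r0: "ok r0" and k: "k < 2"
    and step: "\<And>r. ok r \<Longrightarrow> extends r r0 \<Longrightarrow>
      \<exists>r' b. ok r' \<and> extends r' r \<and> fst r \<le> b \<and> b < fst r' \<and> tag b = k \<and> forces r' (\<noteq>) b"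
  shows "\<not> l_stationary l (active k Y - S)"
proof
  assume stat: "l_stationary l (active k Y - S)"
  (* A strategy may depend only on the moves of I so far. The recursion therefore runs over pairs of a
     stage and a history; the predecessors of a pair are its restrictions to earlier stages. *)
  define W :: "(('k \<times> ('k \<Rightarrow> 'k)) \<times> ('k \<times> ('k \<Rightarrow> 'k))) set"
    where "W = {((i', h'), (i, h)). i' < i \<and> h' = restrict h {..i'}}"
  have "W \<subseteq> inv_image {(x, y). x < y} fst"
    by (auto simp: W_def inv_image_def)
  then have wfW: "wf W"
    using wf_subset[OF wf_inv_image[OF wf]] by blast
  define P where "P F ih r \<longleftrightarrow> (fst ih < l \<longrightarrow> ok r \<and> extends r r0 \<and>
      (\<forall>n<fst ih. extends r (F (n, restrict (snd ih) {..n}))) \<and>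
      (\<exists>b. snd ih (fst ih) \<le> b \<and> b < fst r \<and> tag b = k \<and> forces r (\<noteq>) b) \<and>
      (\<exists>b. snd ih (fst ih) \<le> b \<and> b < fst r \<and> tag b = k \<and> forces r (=) b))"
    for F :: "'k \<times> ('k \<Rightarrow> 'k) \<Rightarrow> 'k \<times> ('k \<Rightarrow> bool \<times> bool)" and ih r
  have restr: "restrict (restrict h {..n}) {..n'} = restrict h {..n'}" if "n' < n" for h :: "'k \<Rightarrow> 'k" and n n'
    by (rule ext) (use order.strict_trans1[OF _ that] in \<open>auto simp: restrict_def less_imp_le\<close>)
  have "\<exists>F. \<forall>ih. P F ih (F ih)"
  proof (rule dependent_wf_choice[OF wfW])
    fix F G :: "'k \<times> ('k \<Rightarrow> 'k) \<Rightarrow> 'k \<times> ('k \<Rightarrow> bool \<times> bool)" and ih r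
    assume eq: "\<And>z. (z, ih) \<in> W \<Longrightarrow> F z = G z"
    have "F (n, restrict (snd ih) {..n}) = G (n, restrict (snd ih) {..n})" if "n < fst ih" for n
      by (rule eq, cases ih) (use that in \<open>simp add: W_def\<close>)
    then show "P F ih r = P G ih r"
      by (simp add: P_def)
  next
    fix ih and F :: "'k \<times> ('k \<Rightarrow> 'k) \<Rightarrow> 'k \<times> ('k \<Rightarrow> bool \<times> bool)"
    assume IH: "\<And>z. (z, ih) \<in> W \<Longrightarrow> P F z (F z)"
    obtain i h where ih: "ih = (i, h)"
      by (cases ih)
    let ?s = "\<lambda>n. F (n, restrict h {..n})"
    have P: "P F (n, restrict h {..n}) (?s n)" if "n < i" for n
      by (rule IH) (use that in \<open>simp add: W_def ih\<close>)
    show "\<exists>r. P F ih r"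
    proof (cases "i < l")
      case True
      have 1: "ok (?s n) \<and> extends (?s n) r0" if "n < i" for n
        using P[OF that] that True unfolding P_def by auto
      have 2: "extends (?s n) (?s n')" if "n' < n" "n < i" for n n'
        using P[OF that(2)] that True restr[OF that(1), of h] unfolding P_def by auto
      obtain r1 where r1: "ok r1" "h i \<le> fst r1" "extends r1 r0" "\<And>n. n < i \<Longrightarrow> extends r1 (?s n)"
        using ok_limit_stage[OF True r0, of ?s "h i"] 1 2 by blast
      obtain r2 b where r2: "ok r2" "extends r2 r1" "fst r1 \<le> b" "b < fst r2" "tag b = k" "forces r2 (\<noteq>) b"
        using step[OF r1(1,3)] by blast
      obtain r3 e where r3: "ok r3" "extends r3 r2" "fst r2 \<le> e" "e < fst r3" "tag e = k" "forces r3 (=) e"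
        using agreement_step[OF r2(1)] by blast
      have "h i \<le> b" "b < fst r3" "h i \<le> e"
        using r1(2) r2(3,4) r3(3,4) by simp_all
      moreover have "extends r3 r1"
        using extends_trans[OF r3(2) r2(2)] .
      ultimately have "P F ih r3"
        unfolding P_def ih
        using r3 r2 r1(3,4) forces_mono[OF r2(6) r3(2)] extends_trans[of r3 r1] by auto
      then show ?thesis
        by blast
    qed (simp add: P_def ih)
  qed
  then obtain F where F: "\<And>ih. P F ih (F ih)"
    by blast
  let ?A = "- (active k Y - S)"
  have "\<nexists>C. C \<subseteq> ?A \<and> l_cub l C"
    using stat unfolding l_stationary_def by blast
  then have "\<not> winning_II l ?A (\<lambda>i h. fst (F (i, h)))"
    using GC unfolding GC_characterization_def by blast
  then obtain \<alpha> \<beta> where \<beta>: "\<And>i. i < l \<Longrightarrow> \<beta> i = fst (F (i, restrict \<alpha> {..i}))"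
    and lose: "(\<exists>i<l. \<not> \<alpha> i < \<beta> i) \<or> (\<forall>i<l. legal_I_at \<alpha> \<beta> i) \<and> seq_sup l \<alpha> \<notin> ?A"
    unfolding winning_II_def by blast
  define s where "s i = F (i, restrict \<alpha> {..i})" for i
  have s: "ok (s i)" "extends (s i) r0" "\<And>n. n < i \<Longrightarrow> extends (s i) (s n)"
      "\<exists>b. \<alpha> i \<le> b \<and> b < fst (s i) \<and> tag b = k \<and> forces (s i) (\<noteq>) b"
      "\<exists>b. \<alpha> i \<le> b \<and> b < fst (s i) \<and> tag b = k \<and> forces (s i) (=) b" if "i < l" for i
    using F[of "(i, restrict \<alpha> {..i})"] that restr[of _ i \<alpha>] unfolding P_def s_def by auto
  have \<beta>s: "\<beta> i = fst (s i)" if "i < l" for i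
    using \<beta>[OF that] by (simp add: s_def)
  have "\<alpha> i < \<beta> i" if "i < l" for i
    using s(4)[OF that] \<beta>s[OF that] by auto
  then have legal: "\<And>i. i < l \<Longrightarrow> legal_I_at \<alpha> \<beta> i" and sup: "seq_sup l \<alpha> \<in> active k Y - S"
    using lose by auto
  define a where "a = seq_sup l \<alpha>"
  have mono: "strict_mono_on {..<l} \<alpha>"
    using legal unfolding legal_I_at_def strict_mono_on_def by auto
  have below: "fst (s i) < a" if i: "i < l" for i
  proof -
    obtain n where n: "i < n" "n < l"
      using l_limit i by blast
    then have "\<beta> i < \<alpha> n" "\<alpha> n < a"
      using legal[of n] less_seq_sup[OF mono n(2)] unfolding legal_I_at_def a_def by auto
    then show ?thesis
      using \<beta>s[OF i] by simp
  qed
  have above: "\<exists>i<l. c < fst (s i)" if c: "c < a" for c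
  proof -
    obtain i where i: "i < l" "c < \<alpha> i"
      using seq_sup_approx[of c \<alpha>] c unfolding a_def by blast
    then have "c < fst (s i)"
      using s(4)[OF i(1)] by auto
    then show ?thesis
      using i(1) by blast
  qed
  have "\<exists>z. ok (a, z) \<and> (\<forall>i\<in>{..<l}. extends (a, z) (s i))"
  proof (rule ok_limit)
    show "ok (s i)" if "i \<in> {..<l}" for i
      using that s(1) by simp
    show "{..<l} \<noteq> {}"
      using l_pos by auto
    show "extends (s i) (s i') \<or> extends (s i') (s i)" if "i \<in> {..<l}" "i' \<in> {..<l}" for i i'
      using that s(3)[of i i'] s(3)[of i' i] extends_refl by (cases i i' rule: linorder_cases) auto
    show "fst (s i) \<le> a" if "i \<in> {..<l}" for i
      using that below by (simp add: less_imp_le)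
    show "(\<exists>i\<in>{..<l}. c \<le> fst (s i)) \<or> (\<exists>b<c. \<forall>i\<in>{..<l}. fst (s i) \<le> b)" if c: "c \<in> S" for c
    proof (cases "c < a")
      case True
      then obtain i where "i < l" "c < fst (s i)"
        using above by blast
      then show ?thesis
        using less_imp_le by blast
    next
      case False
      moreover have "c \<noteq> a"
        using c sup by (auto simp: a_def)
      ultimately have "a < c"
        by simp
      then show ?thesis
        using below less_imp_le by blast
    qed
  qed
  then obtain z where z: "ok (a, z)" "\<And>i. i < l \<Longrightarrow> extends (a, z) (s i)"
    by auto
  obtain x y where xy: "x \<in> C" "y \<in> C" "inside (a, z) x y" "(f x, f y) \<in> R Y"
    using ok_pair[OF z(1)] by blast
  have "good a (cell k) (diff (f x) (f y))"
    using R_D(4)[OF xy(4) k] sup by (simp add: a_def)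
  then obtain c where c: "c < a"
      "cell k \<inter> {c<..<a} \<subseteq> diff (f x) (f y) \<or> cell k \<inter> {c<..<a} \<inter> diff (f x) (f y) = {}"
    unfolding good_def by blast
  obtain i where i: "i < l" "c < \<alpha> i"
    using seq_sup_approx[of c \<alpha>] c(1) unfolding a_def by blast
  have ins: "inside (s i) x y"
    using extends_inside[OF z(2)[OF i(1)] xy(3)] .
  obtain b where b: "\<alpha> i \<le> b" "b < fst (s i)" "tag b = k" "forces (s i) (\<noteq>) b"
    using s(4)[OF i(1)] by blast
  obtain e where e: "\<alpha> i \<le> e" "e < fst (s i)" "tag e = k" "forces (s i) (=) e"
    using s(5)[OF i(1)] by blast
  have "b \<in> cell k \<inter> {c<..<a}" "e \<in> cell k \<inter> {c<..<a}"
    using b e i(2) below[OF i(1)] by auto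
  moreover have "b \<in> diff (f x) (f y)" "e \<notin> diff (f x) (f y)"
    using b(4) e(4) ins xy(1,2) unfolding forces_def diff_def by auto
  ultimately show False
    using c(2) by blast
qed

text \<open>
  The strategy needs differences in one fixed cell. Either differences with tag 0 are always
  available, or from some condition on they are not, and then those with tag 1 always are.
\<close>

lemma nonreduction_aux:
  assumes GC: "GC_characterization l"
  shows "\<exists>k<2. \<not> l_stationary l (active k Y - S)"
proof (cases "\<forall>r. ok r \<longrightarrow> (\<exists>r' b. ok r' \<and> extends r' r \<and> fst r \<le> b \<and> b < fst r' \<and> tag b = 0 \<and> forces r' (\<noteq>) b)")
  case True
  obtain a where a: "mark < a"
    using ex_greater by blast
  have "good c P {}" if "c \<in> S" for c P
    using that S by (auto intro: good_empty)
  then have "ok (a, \<lambda>_. (False, False))"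
    using a by (simp add: ok_def conflict_def)
  then have "\<not> l_stationary l (active 0 Y - S)"
    by (rule game[OF GC]) (use True in auto)
  then show ?thesis
    by (intro exI[of _ 0]) simp
next
  case False
  then obtain r0 where r0: "ok r0"
    "\<And>r' b. ok r' \<Longrightarrow> extends r' r0 \<Longrightarrow> fst r0 \<le> b \<Longrightarrow> b < fst r' \<Longrightarrow> tag b = 0 \<Longrightarrow> \<not> forces r' (\<noteq>) b"
    by blast
  have "\<not> l_stationary l (active 1 Y - S)"
  proof (rule game[OF GC r0(1)])
    fix r assume r: "ok r" "extends r r0"
    obtain r' b where r': "ok r'" "extends r' r" "fst r \<le> b" "b < fst r'" "tag b < 2" "forces r' (\<noteq>) b"
      using difference_step[OF r(1)] by blast
    have "extends r' r0"
      using extends_trans[OF r'(2) r(2)] .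
    moreover have "fst r0 \<le> b"
      using r(2) r'(3) by (auto simp: extends_def)
    ultimately have "tag b \<noteq> 0"
      using r0(2) r' by blast
    then have "tag b = 1"
      using r'(5) by simp
    then show "\<exists>r' b. ok r' \<and> extends r' r \<and> fst r \<le> b \<and> b < fst r' \<and> tag b = 1 \<and> forces r' (\<noteq>) b"
      using r' by blast
  qed simp
  then show ?thesis
    by (intro exI[of _ 1]) simp
qed

end

theorem nonreduction:
  assumes GC: "GC_characterization l" and red: "E \<le>\<^sub>B R Y"
    and rel: "\<And>x D. \<not> x mark \<Longrightarrow> D \<subseteq> cell j \<Longrightarrow> bdd_above D \<Longrightarrow>
      (\<And>a. a \<in> S \<Longrightarrow> good a (cell j) D) \<Longrightarrow> (x, flip D x) \<in> E"
    and unrel: "\<And>x b. (x, flip (cell j \<inter> {b..}) x) \<notin> E"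
    and S: "S \<subseteq> lim_points"
  shows "\<exists>k<2. \<not> l_stationary l (active k Y - S)"
proof -
  obtain f where f: "borel_function f" "\<And>x y. (x, y) \<in> E \<longleftrightarrow> (f x, f y) \<in> R Y"
    using red unfolding borel_reducible_def by blast
  obtain C where C: "comeager C"
      "\<And>x b. x \<in> C \<Longrightarrow> \<exists>a. \<forall>y\<in>C. agree a x y \<longrightarrow> agree b (f x) (f y)"
    using continuous_on_comeager[OF f(1)] by blast
  show ?thesis
  proof (rule nonreduction_aux)
    show "(x, y) \<in> E \<longleftrightarrow> (f x, f y) \<in> R Y" for x y
      by (rule f(2))
    show "(x, flip D x) \<in> E" if "\<not> x mark" "D \<subseteq> cell j" "bdd_above D"
      "\<And>a. a \<in> S \<Longrightarrow> good a (cell j) D" for x D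
      by (rule rel) (use that in auto)
    show "(x, flip (cell j \<inter> {b..}) x) \<notin> E" for x b
      by (rule unrel)
    show "\<exists>a. \<forall>y\<in>C. agree a x y \<longrightarrow> agree b (f x) (f y)" if "x \<in> C" for x b
      by (rule C(2)[OF that])
  qed (fact S C(1) GC)+
qed

lemma diff_flip: "diff x (flip D x) = D"
  by (auto simp: diff_def flip_def)

lemma unbounded_tail: "\<not> bdd_above (cell j \<inter> {b..})"
  unfolding not_bdd_iff
proof
  fix c
  obtain d where "tag d = j" "max b c < d"
    using unbounded_tag[of j] unfolding not_bdd_iff by blast
  then show "\<exists>d\<in>cell j \<inter> {b..}. c < d"
    by auto
qed

text \<open>Both sets of active points are stationary, whatever \<open>X\<close> is.\<close>

lemma E0_not_le_R:
  assumes "GC_characterization l"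
  shows "\<not> E0 \<le>\<^sub>B R X"
proof
  assume "E0 \<le>\<^sub>B R X"
  then have "\<exists>k<2. \<not> l_stationary l (active k X - {})"
    by (rule nonreduction[OF assms, where j = 0]) (simp_all add: E0_diff diff_flip unbounded_tail)
  then show False
    using active_stationary by simp
qed

text \<open>
  For either cell \<open>j\<close>, the limit points outside \<open>Y\<close> are active for \<open>Y\<close> whichever \<open>k\<close> the game
  provides. So those of them that are not active for \<open>X\<close> in the cell \<open>j\<close> form a non-stationary set;
  these are the points of \<open>X - Y\<close> in \<open>A\<close> for \<open>j = 0\<close>, and those outside \<open>A\<close> for \<open>j = 1\<close>.
\<close>

lemma R_le_R_imp:
  assumes GC: "GC_characterization l" and red: "R X \<le>\<^sub>B R Y"
  shows "subset_NS l X Y"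
proof -
  have non: "\<not> l_stationary l (lim_points - Y - active j X)" if j: "j < 2" for j
  proof -
    have "\<exists>k<2. \<not> l_stationary l (active k Y - active j X)"
    proof (rule nonreduction[OF GC red, where j = j])
      show "(x, flip D x) \<in> R X" if "\<not> x mark" "D \<subseteq> cell j" "bdd_above D"
        "\<And>a. a \<in> active j X \<Longrightarrow> good a (cell j) D" for x D
      proof (rule R_I)
        show "x a = flip D x a" if "2 \<le> tag a" for a
          using that \<open>D \<subseteq> cell j\<close> j by (auto simp: flip_def)
        show "good a (cell j') (diff x (flip D x))" if a: "a \<in> active j' X" for j' a
        proof (cases "j' = j")
          case True
          then show ?thesis
            using a \<open>\<And>a. a \<in> active j X \<Longrightarrow> good a (cell j) D\<close> by (simp add: diff_flip)
        next
          case False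
          obtain b where "b < a"
            using active_lim[OF a] lim_points_less by blast
          then show ?thesis
            using False \<open>D \<subseteq> cell j\<close> by (intro goodI_bdd[of b]) (auto simp: diff_flip)
        qed
      qed (use \<open>\<not> x mark\<close> \<open>bdd_above D\<close> in \<open>simp_all add: diff_flip\<close>)
      show "(x, flip (cell j \<inter> {b..}) x) \<notin> R X" for x b
        using R_D(1)[of x "flip (cell j \<inter> {b..}) x" X] unbounded_tail[of j b] by (auto simp: diff_flip)
      show "active j X \<subseteq> lim_points"
        using active_lim by blast
    qed
    then obtain k where k: "k < 2" "\<not> l_stationary l (active k Y - active j X)"
      by blast
    have "lim_points - Y - active j X \<subseteq> active k Y - active j X"
      by (auto simp: active_def)
    then show ?thesis
      using k(2) stationary_mono by blast
  qed
  have "(X - Y) \<inter> lim_points \<inter> A \<subseteq> lim_points - Y - active 0 X"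
    by (auto simp: active_def)
  then have 0: "\<not> l_stationary l ((X - Y) \<inter> lim_points \<inter> A)"
    using non[of 0] stationary_mono by auto
  have "(X - Y) \<inter> lim_points - A \<subseteq> lim_points - Y - active 1 X"
    by (auto simp: active_def)
  then have 1: "\<not> l_stationary l ((X - Y) \<inter> lim_points - A)"
    using non[of 1] stationary_mono by auto
  show ?thesis
    unfolding subset_NS_def using 0 1 stationary_split_cases by blast
qed

text \<open>
  A generic point and its flip in a whole cell have different images, and the difference is decided by
  initial segments. But a flip of an initial segment of the cell does not leave the class.
\<close>

lemma R_not_le_Id: "\<not> R X \<le>\<^sub>B Id"
proof
  assume "R X \<le>\<^sub>B Id"
  then obtain f where f: "borel_function f" "\<And>x y. (x, y) \<in> R X \<longleftrightarrow> f x = f y"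
    unfolding borel_reducible_def by auto
  obtain C where C: "comeager C"
      and cont: "\<And>x b. x \<in> C \<Longrightarrow> \<exists>a. \<forall>y\<in>C. agree a x y \<longrightarrow> agree b (f x) (f y)"
    using continuous_on_comeager[OF f(1)] by blast
  obtain a0 where a0: "mark < a0"
    using ex_greater by blast
  let ?P = "cell 0 :: 'k set"
  obtain x where x: "x \<in> C" "flip ?P x \<in> C" "agree a0 (\<lambda>_. False) x"
    using generic_point[OF C, of ?P "{}" a0 "\<lambda>_. False"] by blast
  have nm: "\<not> x mark"
    using agreeD[OF x(3) a0] by simp
  have "(x, flip ?P x) \<notin> R X"
    using R_D(1)[of x "flip ?P x" X] unbounded_tag[of 0] by (auto simp: diff_flip)
  then obtain b where b: "f x b \<noteq> f (flip ?P x) b"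
    using f(2) by blast
  obtain b1 where b1: "b < b1"
    using ex_greater by blast
  obtain g1 where g1: "\<forall>y\<in>C. agree g1 x y \<longrightarrow> agree b1 (f x) (f y)"
    using cont[OF x(1)] by blast
  obtain g2 where g2: "\<forall>y\<in>C. agree g2 (flip ?P x) y \<longrightarrow> agree b1 (f (flip ?P x)) (f y)"
    using cont[OF x(2)] by blast
  obtain g where g: "max a0 (max g1 g2) < g"
    using ex_greater by blast
  let ?D = "?P \<inter> {..<g}"
  obtain x' where x': "x' \<in> C" "flip ?D x' \<in> C" "agree g x x'"
    using generic_point[OF C, of ?D "{}" g x] by blast
  have "agree g1 x x'" "agree g2 (flip ?P x) (flip ?D x')"
    using x'(3) g by (auto simp: agree_def flip_def)
  then have "agree b1 (f x) (f x')" "agree b1 (f (flip ?P x)) (f (flip ?D x'))"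
    using g1 g2 x'(1,2) by simp_all
  then have "f x b = f x' b" "f (flip ?P x) b = f (flip ?D x') b"
    by (simp_all add: agreeD[OF _ b1])
  moreover have "(x', flip ?D x') \<in> R X"
  proof (rule R_I)
    show "bdd_above (diff x' (flip ?D x'))"
      unfolding diff_flip by (rule bdd_aboveI[of _ g]) auto
    show "x' a = flip ?D x' a" if "2 \<le> tag a" for a
      using that by (auto simp: flip_def)
    show "x' (pos 0 a l) = flip ?D x' (pos 0 a l)" if "x' mark" for a
      using that nm agreeD[OF x'(3), of mark] less_trans[OF a0, of g] g by simp
    show "good a (cell j) (diff x' (flip ?D x'))" if a: "a \<in> active j X" for a j
    proof -
      obtain b where b: "b < a"
        using active_lim[OF a] lim_points_less by blast
      show ?thesis
      proof (cases "j = 0 \<and> a \<le> g")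
        case True
        then have "cell j \<inter> {b<..<a} \<subseteq> diff x' (flip ?D x')"
          unfolding diff_flip by auto
        then show ?thesis
          unfolding good_def using b by blast
      next
        case False
        show ?thesis
          unfolding diff_flip by (rule goodI_bdd[of "if j = 0 then g else b"]) (use b False in \<open>auto split: if_splits\<close>)
      qed
    qed
  qed
  then have "f x' b = f (flip ?D x') b"
    using f(2) by simp
  ultimately show False
    using b by simp
qed

end

theorem theorem11:
  fixes l :: "'k::wellorder"
  assumes "regular_cardinal (kappa :: 'k rel)"
    and "natLeq <o (kappa :: 'k rel)"
    and "\<forall>a::'k. {..<a} \<noteq> {} \<longrightarrow> (kappa :: 'k rel) ^c |{..<a}| =o (kappa :: 'k rel)"
    and "regular_below l"
    and "GC_characterization l"
  shows "\<exists>F :: 'k set \<Rightarrow> ('k \<Rightarrow> bool) rel.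
    inj F \<and> range F \<subseteq> borel_equivs \<and>
    (\<forall>X. Id <\<^sub>B F X \<and> F X <\<^sub>B E0) \<and>
    (\<forall>X Y. subset_NS l X Y \<longleftrightarrow> F X \<le>\<^sub>B F Y)"
proof -
  obtain dec where dec: "regular_pair l dec"
    using regular_pair_exists[OF assms(1,4)] by blast
  interpret regular_pair l dec
    by (rule dec)
  obtain A where A: "A \<subseteq> lim_points" "l_stationary l A" "l_stationary l (lim_points - A)"
    using stationary_splitting by blast
  interpret split_pair l dec A
    by unfold_locales (fact A)+
  have "subset_NS l X Y \<longleftrightarrow> R X \<le>\<^sub>B R Y" for X Y
  proof
    assume "subset_NS l X Y"
    then obtain C where "l_cub l C" "(X - Y) \<inter> C = {}"
      unfolding subset_NS_def l_stationary_def by blast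
    then show "R X \<le>\<^sub>B R Y"
      by (rule R_le_R)
  qed (rule R_le_R_imp[OF assms(5)])
  moreover have "Id <\<^sub>B R X \<and> R X <\<^sub>B E0" for X
    unfolding strictly_borel_reducible_def
    using Id_le_R R_not_le_Id R_le_E0 E0_not_le_R[OF assms(5)] by simp
  moreover have "range R \<subseteq> borel_equivs"
    using R_borel_equiv by auto
  ultimately show ?thesis
    using inj_R by (intro exI[of _ R]) simp
qed

end
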